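(* Let $d\ge 3$ and let $\mathbb{P}_d$ be a finite classical polar space of rank $d$ over $\mathbb{F}_q$ with parameter $e$. Let $L$ be a $(d-1)$-dimensional subspace of $\mathbb{P}_d$ and $P_1,\dots,P_{q^e+1}$ the generators containing $L$. Let $\pi$ be a $(d-2)$-dimensional subspace of $P_1$ with $\pi\nsubseteq L$, let $\ell$ be a line of $\mathbb{P}_d$ contained in $\pi^\perp$ and meeting $P_1$ trivially, and let $z$ be a point of $\ell$. Let $H_z=z^\perp\cap P_1$ and let $H_z'\ne H_z$ be a $(d-1)$-dimensional subspace of $P_1$ that is parallel to $H_z$ in $\tilde P_1=P_1\setminus L$. Let $\sigma_1$ be the permutation of the hyperplanes of $\tilde P_1$ that swaps $H_z$ with $H_z'$ (more precisely $H_z\setminus L$ with $H_z'\setminus L$) and fixes all other hyperplanes of $\tilde P_1$, and let $\Gamma_1=\Gamma(L,\sigma_1,\mathrm{id},\dots,\mathrm{id})$. Let $\Gamma_0$ be the collinearity graph of $\mathbb{P}_d$. Then $\Gamma_0$ and $\Gamma_1$ are not isomorphic.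
   Context: Polar spaces. Let $q$ be a prime power and $d\ge 1$. A finite classical polar space $\mathbb{P}_d$ of rank $d$ consists of the isotropic subspaces of a finite vector space $V$ with a form, of one of six types, each with a parameter $e$: $O^+(2d,q)$: $V=\mathbb{F}_q^{2d}$, quadratic form $x_1x_2+\dots+x_{2d-1}x_{2d}$, $e=0$; $O(2d+1,q)$: $V=\mathbb{F}_q^{2d+1}$, quadratic form $x_1^2+x_2x_3+\dots+x_{2d}x_{2d+1}$, $e=1$; $O^-(2d+2,q)$: $V=\mathbb{F}_q^{2d+2}$, quadratic form $f(x_1,x_2)+x_3x_4+\dots+x_{2d+1}x_{2d+2}$ with $f$ a homogeneous quadratic polynomial irreducible over $\mathbb{F}_q$, $e=2$; $Sp(2d,q)$: $V=\mathbb{F}_q^{2d}$, symplectic form $x_1y_2-x_2y_1+\dots+x_{2d-1}y_{2d}-x_{2d}y_{2d-1}$, $e=1$; for $q$ a square, $U(2d,q)$: $V=\mathbb{F}_q^{2d}$, Hermitian form $\sum_i x_iy_i^{\sqrt q}$, $e=1/2$; and $U(2d+1,q)$: $V=\mathbb{F}_q^{2d+1}$, Hermitian form $\sum_i x_iy_i^{\sqrt q}$, $e=3/2$. A subspace of $V$ is isotropic if the form vanishes identically on it; isotropic subspaces are called subspaces of $\mathbb{P}_d$. Dimensions are vector space dimensions. Points are $1$-dimensional, and lines $2$-dimensional, subspaces of $\mathbb{P}_d$; generators are the maximal isotropic subspaces, all of dimension $d$. Subspaces are identified with their sets of points. For a subspace $S$ of $\mathbb{P}_d$, $S^\perp$ is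 the set of points $p$ of $\mathbb{P}_d$ with $\langle S,p\rangle$ isotropic. The collinearity graph $\Gamma_0$ has the points of $\mathbb{P}_d$ as vertices, two distinct points $x,y$ being adjacent iff $x\in y^\perp$. Construction of $\Gamma(L,\sigma_1,\dots,\sigma_{q^e+1})$. Let $X$ be the set of points of $\mathbb{P}_d$ and $L$ a $(d-1)$-dimensional subspace of $\mathbb{P}_d$. Then $L$ lies in exactly $q^e+1$ generators $P_1,\dots,P_{q^e+1}$. Let $\tilde P_i=P_i\setminus L$ be the affine geometry with $L$ as hyperplane at infinity: its hyperplanes are the sets $H\setminus L$ with $H\neq L$ a $(d-1)$-dimensional subspace of $P_i$, and $H\setminus L$, $H'\setminus L$ are in the same parallel class (are parallel) iff $H\cap L=H'\cap L$. Let $Z$ be the set of points of $\mathbb{P}_d$ not in $L^\perp$; thus $X$ is the disjoint union of $L$, $\tilde P_1,\dots,\tilde P_{q^e+1}$ and $Z$. Each $\sigma_i$ is a permutation (not necessarily induced by a collineation) of the set of hyperplanes of $\tilde P_i$ mapping every parallel class onto itself. For $z\in Z$, $z^\perp\cap P_i$ is a $(d-1)$-dimensional subspace of $P_i$ different from $L$, so $z^\perp\cap\tilde P_i$ is a hyperplane of $\tilde P_i$. The graph $\Gamma(L,\sigma_1,\dots,\sigma_{q^e+1})$ has vertex set $X$; distinct vertices $x,y$ are adjacent as follows: if $x\in\tilde P_i$ and $y\in Z$ (or vice versa, by symmetry), they are adjacent iff $x\in(y^\perp\cap\tilde P_i)^{\sigma_i}$; in all other cases they are adjacent iff $x\in y^\perp$.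 In the setting of the claim, all points of $\ell$ lie in $Z$. *)

theory Defs
  imports
    "HOL-Analysis.Analysis"
    "HOL-Computational_Algebra.Computational_Algebra"
    "Graph_Theory.Graph_Theory"
begin

section \<open>Finite classical polar spaces\<close>

text \<open>
  The field is \<open>'a\<close>, so \<open>q = CARD('a)\<close>, and \<open>V = 'a ^ 'n\<close>. Where the standard form refers to
  numbered coordinates, these are supplied by a bijection \<open>c\<close> from \<open>{1..n}\<close> onto \<open>'n\<close>: the
  coordinate \<open>x\<^sub>k\<close> of \<open>x\<close> is \<open>x $ c k\<close>. A polar space is represented by the set of its (isotropic)
  subspaces, each of which is a set of vectors.
\<close>

definition totally_singular :: "('a::field ^ 'n \<Rightarrow> 'a) \<Rightarrow> ('a ^ 'n) set set" where
  "totally_singular Q = {S. vec.subspace S \<and> (\<forall>x\<in>S. Q x = 0)}"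

definition totally_isotropic :: "('a::field ^ 'n \<Rightarrow> 'a ^ 'n \<Rightarrow> 'a) \<Rightarrow> ('a ^ 'n) set set" where
  "totally_isotropic B = {S. vec.subspace S \<and> (\<forall>x\<in>S. \<forall>y\<in>S. B x y = 0)}"

text \<open>
  A polynomial in two variables \<open>X\<^sub>1, X\<^sub>2\<close> is an element of \<open>'a poly poly\<close>, that is, a polynomial in
  \<open>X\<^sub>1\<close> whose coefficients are polynomials in \<open>X\<^sub>2\<close>.
\<close>

definition homogeneous_quadratic :: "'a::zero poly poly \<Rightarrow> bool" where
  "homogeneous_quadratic f \<longleftrightarrow> (\<forall>i j. coeff (coeff f i) j \<noteq> 0 \<longrightarrow> i + j = 2)"

definition eval2 :: "'a::comm_semiring_0 poly poly \<Rightarrow> 'a \<Rightarrow> 'a \<Rightarrow> 'a" where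
  "eval2 f x\<^sub>1 x\<^sub>2 = poly (poly f [:x\<^sub>1:]) x\<^sub>2"

text \<open>
  \<open>classical_polar_space d e \<P>\<close>: \<open>\<P>\<close> is the set of subspaces of a finite classical polar space of
  rank \<open>d\<close> with parameter \<open>e\<close> over \<open>'a\<close>. In the two unitary cases \<open>r = \<surd>q\<close>.
\<close>

inductive classical_polar_space ::
  "nat \<Rightarrow> real \<Rightarrow> ('a::{field,finite} ^ 'n::finite) set set \<Rightarrow> bool" where
  O_plus:
    "d \<ge> 1 \<Longrightarrow> bij_betw c {1..2*d} (UNIV :: 'n set) \<Longrightarrow>
     classical_polar_space d 0
       (totally_singular (\<lambda>x :: 'a ^ 'n. \<Sum>i=1..d. x $ c (2*i - 1) * x $ c (2*i)))"
| O_odd: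
    "d \<ge> 1 \<Longrightarrow> bij_betw c {1..2*d + 1} (UNIV :: 'n set) \<Longrightarrow>
     classical_polar_space d 1
       (totally_singular (\<lambda>x :: 'a ^ 'n. (x $ c 1)\<^sup>2 + (\<Sum>i=1..d. x $ c (2*i) * x $ c (2*i + 1))))"
| O_minus:
    "d \<ge> 1 \<Longrightarrow> bij_betw c {1..2*d + 2} (UNIV :: 'n set) \<Longrightarrow>
     homogeneous_quadratic f \<Longrightarrow> irreducible f \<Longrightarrow>
     classical_polar_space d 2
       (totally_singular (\<lambda>x :: 'a ^ 'n. eval2 f (x $ c 1) (x $ c 2)
          + (\<Sum>i=1..d. x $ c (2*i + 1) * x $ c (2*i + 2))))"
| Sp:
    "d \<ge> 1 \<Longrightarrow> bij_betw c {1..2*d} (UNIV :: 'n set) \<Longrightarrow>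
     classical_polar_space d 1
       (totally_isotropic (\<lambda>x y :: 'a ^ 'n.
          \<Sum>i=1..d. x $ c (2*i - 1) * y $ c (2*i) - x $ c (2*i) * y $ c (2*i - 1)))"
| U_even:
    "d \<ge> 1 \<Longrightarrow> CARD('n) = 2*d \<Longrightarrow> r\<^sup>2 = CARD('a) \<Longrightarrow>
     classical_polar_space d (1/2) (totally_isotropic (\<lambda>x y :: 'a ^ 'n. \<Sum>i\<in>UNIV. x $ i * (y $ i) ^ r))"
| U_odd:
    "d \<ge> 1 \<Longrightarrow> CARD('n) = 2*d + 1 \<Longrightarrow> r\<^sup>2 = CARD('a) \<Longrightarrow>
     classical_polar_space d (3/2) (totally_isotropic (\<lambda>x y :: 'a ^ 'n. \<Sum>i\<in>UNIV. x $ i * (y $ i) ^ r))"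

definition points :: "('a::field ^ 'n) set set \<Rightarrow> ('a ^ 'n) set set" where
  "points \<P> = {p \<in> \<P>. vec.dim p = 1}"

definition generators :: "('a::field ^ 'n) set set \<Rightarrow> ('a ^ 'n) set set" where
  "generators \<P> = {G \<in> \<P>. \<forall>H\<in>\<P>. G \<subseteq> H \<longrightarrow> H = G}"

definition points_in :: "('a::field ^ 'n) set set \<Rightarrow> ('a ^ 'n) set \<Rightarrow> ('a ^ 'n) set set" where
  "points_in \<P> S = {p \<in> points \<P>. p \<subseteq> S}"

definition perp :: "('a::field ^ 'n) set set \<Rightarrow> ('a ^ 'n) set \<Rightarrow> ('a ^ 'n) set set" where
  "perp \<P> S = {p \<in> points \<P>. vec.span (S \<union> p) \<in> \<P>}"

definition collinearity_graph :: "('a::field ^ 'n) set set \<Rightarrow> ('a ^ 'n) set pair_pre_digraph" where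
  "collinearity_graph \<P> =
     \<lparr> pverts = points \<P>,
       parcs = {(x, y). x \<in> points \<P> \<and> y \<in> points \<P> \<and> x \<noteq> y \<and> x \<in> perp \<P> y} \<rparr>"


section \<open>The graph \<open>\<Gamma>(L, \<sigma>\<^sub>1, \<dots>, \<sigma>\<^sub>N)\<close>\<close>

text \<open>The affine geometry on the points of \<open>P\<close> not in its hyperplane \<open>L\<close>; it and its hyperplanes are
  sets of points.\<close>

definition affine_part ::
  "('a::field ^ 'n) set set \<Rightarrow> ('a ^ 'n) set \<Rightarrow> ('a ^ 'n) set \<Rightarrow> ('a ^ 'n) set set" where
  "affine_part \<P> L P = points_in \<P> P - points_in \<P> L"

definition parallel ::
  "('a::field ^ 'n) set set \<Rightarrow> ('a ^ 'n) set \<Rightarrow> ('a ^ 'n) set \<Rightarrow>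
     ('a ^ 'n) set set \<Rightarrow> ('a ^ 'n) set set \<Rightarrow> bool" where
  "parallel \<P> L P h h' \<longleftrightarrow>
     (\<exists>H H'. H \<in> \<P> \<and> H \<subseteq> P \<and> vec.dim H + 1 = vec.dim P \<and> H \<noteq> L \<and> h = affine_part \<P> L H \<and>
             H' \<in> \<P> \<and> H' \<subseteq> P \<and> vec.dim H' + 1 = vec.dim P \<and> H' \<noteq> L \<and> h' = affine_part \<P> L H' \<and>
             H \<inter> L = H' \<inter> L)"

definition far_points :: "('a::field ^ 'n) set set \<Rightarrow> ('a ^ 'n) set \<Rightarrow> ('a ^ 'n) set set" where
  "far_points \<P> L = points \<P> - perp \<P> L"

text \<open>
  \<open>P 1, \<dots>, P N\<close> are meant to be the generators containing \<open>L\<close>, and \<open>\<sigma> i\<close> a permutation of the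
  hyperplanes of \<open>affine_part \<P> L (P i)\<close> that maps every parallel class onto itself.
\<close>

definition switched_adj ::
  "('a::field ^ 'n) set set \<Rightarrow> ('a ^ 'n) set \<Rightarrow> nat \<Rightarrow> (nat \<Rightarrow> ('a ^ 'n) set) \<Rightarrow>
     (nat \<Rightarrow> ('a ^ 'n) set set \<Rightarrow> ('a ^ 'n) set set) \<Rightarrow> ('a ^ 'n) set \<Rightarrow> ('a ^ 'n) set \<Rightarrow> bool" where
  "switched_adj \<P> L N P \<sigma> x y \<longleftrightarrow>
     (if \<exists>i\<in>{1..N}. x \<in> affine_part \<P> L (P i) \<and> y \<in> far_points \<P> L
      then \<exists>i\<in>{1..N}. x \<in> affine_part \<P> L (P i) \<and> x \<in> \<sigma> i (perp \<P> y \<inter> affine_part \<P> L (P i))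
      else if \<exists>i\<in>{1..N}. y \<in> affine_part \<P> L (P i) \<and> x \<in> far_points \<P> L
      then \<exists>i\<in>{1..N}. y \<in> affine_part \<P> L (P i) \<and> y \<in> \<sigma> i (perp \<P> x \<inter> affine_part \<P> L (P i))
      else x \<in> perp \<P> y)"

definition switched_graph ::
  "('a::field ^ 'n) set set \<Rightarrow> ('a ^ 'n) set \<Rightarrow> nat \<Rightarrow> (nat \<Rightarrow> ('a ^ 'n) set) \<Rightarrow>
     (nat \<Rightarrow> ('a ^ 'n) set set \<Rightarrow> ('a ^ 'n) set set) \<Rightarrow> ('a ^ 'n) set pair_pre_digraph" where
  "switched_graph \<P> L N P \<sigma> =
     \<lparr> pverts = points \<P>,
       parcs = {(x, y). x \<in> points \<P> \<and> y \<in> points \<P> \<and> x \<noteq> y \<and> switched_adj \<P> L N P \<sigma> x y} \<rparr>"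

text \<open>
  \<^const>\<open>digraph_iso\<close> entails well-formedness, so its negation is informative only because both
  graphs are genuine simple graphs:
\<close>

lemma perp_commute: "x \<in> points \<P> \<Longrightarrow> y \<in> points \<P> \<Longrightarrow> x \<in> perp \<P> y \<longleftrightarrow> y \<in> perp \<P> x"
  by (simp add: perp_def Un_commute)

lemma pair_graph_collinearity_graph:
  "pair_graph (collinearity_graph (\<P> :: ('a::{field,finite} ^ 'n) set set))"
  by unfold_locales
     (auto simp: collinearity_graph_def symmetric_def perp_commute intro!: symI)

lemma affine_part_not_far:
  assumes "x \<in> affine_part \<P> L G" "x \<in> far_points \<P> L" "L \<subseteq> G" "G \<in> \<P>"
    and down: "\<And>S. vec.subspace S \<Longrightarrow> S \<subseteq> G \<Longrightarrow> S \<in> \<P>" and "vec.subspace G"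
  shows False
proof -
  have "vec.span (L \<union> x) \<subseteq> G"
    using assms by (intro vec.span_minimal) (auto simp: affine_part_def points_in_def)
  then have "vec.span (L \<union> x) \<in> \<P>"
    using down vec.subspace_span by blast
  with assms show False
    by (auto simp: far_points_def perp_def)
qed

lemma classical_polar_space_subspace:
  assumes "classical_polar_space d e \<P>" "G \<in> \<P>"
  shows "vec.subspace G" "vec.subspace S \<Longrightarrow> S \<subseteq> G \<Longrightarrow> S \<in> \<P>"
  using assms
  by (auto elim!: classical_polar_space.cases simp: totally_singular_def totally_isotropic_def subset_iff)

lemma pair_graph_switched_graph:
  assumes \<P>: "classical_polar_space d e \<P>" and P: "\<And>i. i \<in> {1..N} \<Longrightarrow> P i \<in> \<P> \<and> L \<subseteq> P i"
  shows "pair_graph (switched_graph \<P> L N P \<sigma>)"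
proof -
  have disj: False if "x \<in> affine_part \<P> L (P i)" "x \<in> far_points \<P> L" "i \<in> {1..N}" for x i
    using affine_part_not_far[OF that(1,2)] classical_polar_space_subspace[OF \<P>] P[OF that(3)]
    by blast
  have "switched_adj \<P> L N P \<sigma> x y \<longleftrightarrow> switched_adj \<P> L N P \<sigma> y x"
    if "x \<in> points \<P>" "y \<in> points \<P>" for x y
  proof -
    let ?c = "\<lambda>x y. \<exists>i\<in>{1..N}. x \<in> affine_part \<P> L (P i) \<and> y \<in> far_points \<P> L"
    have "\<not> (?c x y \<and> ?c y x)"
      using disj by blast
    then show ?thesis
      unfolding switched_adj_def using perp_commute[OF that]
      by (cases "?c x y"; cases "?c y x") (simp_all only: if_True if_False simp_thms)
  qed
  then show ?thesis
    by unfold_locales (auto simp: switched_graph_def symmetric_def intro!: symI)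
qed

end

theory Submission
  imports Defs "HOL-Algebra.Sylow"
begin

text \<open>
  In \<open>\<Gamma>\<^sub>0\<close> every edge lies on a line, that is, a set of \<open>q + 1\<close> vertices each of which is equal or
  adjacent to every vertex that is equal or adjacent to both ends of the edge. In \<open>\<Gamma>\<^sub>1\<close> this fails for an edge
  \<open>{x, y}\<close> on \<open>\<ell>\<close> with \<open>x, y \<noteq> z\<close>. Indeed, \<open>x\<close> and \<open>y\<close> have the same neighbours in both graphs, because
  \<open>x\<^sup>\<perp> \<inter> P\<^sub>1\<close> is neither \<open>H\<^sub>z\<close> (otherwise \<open>\<ell>\<close> would contain a point orthogonal to \<open>P\<^sub>1\<close>) nor \<open>H\<^sub>z'\<close> (it
  contains \<open>\<pi>\<close>, while \<open>H\<^sub>z\<close> and \<open>H\<^sub>z'\<close> meet inside \<open>L\<close>). In \<open>\<Gamma>\<^sub>0\<close> the vertices adjacent or equal to all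
  common neighbours of \<open>x\<close> and \<open>y\<close> are the points of \<open>\<ell>\<close>; the switching creates no new ones, and it removes
  \<open>z\<close>, which is no longer adjacent to the points of \<open>\<pi> \<setminus> L\<close>. So at most \<open>q\<close> vertices remain.
\<close>

unbundle no Formal_Power_Series.fps_syntax

section \<open>Finite fields\<close>

text \<open>By Sylow's theorem the additive group has a subgroup \<open>H\<close> of order
  \<open>l\<close>. Translation by an element \<open>x\<close> of \<open>H\<close> permutes
  \<open>H\<close>, so comparing sums over \<open>H\<close> gives \<open>of_nat l * x = 0\<close>.
  For \<open>l\<close> other than the characteristic this forces \<open>H\<close> to be
  trivial.\<close>

lemma prime_dvd_CARD_eq_CHAR:
  assumes "prime l" "l dvd CARD('a::{field,finite})"
  shows "l = CHAR('a)"
proof (rule ccontr)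
  assume ne: "l \<noteq> CHAR('a)"
  let ?G = "\<lparr>carrier = (UNIV :: 'a set), monoid.mult = (+), one = 0\<rparr>"
  interpret group ?G
    by (rule groupI) (auto simp: add.assoc intro: exI[of _ "- x" for x])
  have prime: "prime CHAR('a)"
    using finite_imp_CHAR_pos[where ?'a = 'a] prime_CHAR_semidom[where ?'a = 'a] by simp
  obtain m where "CARD('a) = l ^ 1 * m"
    using assms(2) by auto
  then obtain H where H: "subgroup H ?G" "card H = l ^ 1"
    using sylow_thm[OF assms(1) is_group, of 1 m] by (auto simp: Coset.order_def)
  have add: "x + y \<in> H" if "x \<in> H" "y \<in> H" for x y
    using subgroup.m_closed[OF H(1) that] by simp
  have "H \<subseteq> {0}"
  proof
    fix x assume "x \<in> H"
    have "bij_betw ((+) x) H H"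
      using \<open>x \<in> H\<close> add endo_inj_surj[of H "(+) x"] by (auto simp: bij_betw_def image_subset_iff)
    then have "(\<Sum>y\<in>H. x + y) = \<Sum>H"
      by (rule sum.reindex_bij_betw)
    then have "of_nat l * x = 0"
      using H(2) by (simp add: sum.distrib)
    moreover have "of_nat l \<noteq> (0 :: 'a)"
      using ne assms(1) prime primes_dvd_imp_eq of_nat_eq_0_iff_char_dvd by blast
    ultimately show "x \<in> {0}"
      by simp
  qed
  then have "card H \<le> 1"
    using card_mono[of "{0 :: 'a}" H] by simp
  then show False
    using H(2) assms(1) prime_gt_1_nat[of l] by simp
qed

text \<open>Every prime factor of \<open>r\<close> is the characteristic, so \<open>r\<close> is a
  power of it and the \<open>r\<close>-th power is an iterate of Frobenius. It is applied with
  \<open>r\<^sup>2 = CARD('a)\<close>.\<close>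

lemma power_add_of_dvd_CARD:
  fixes x y :: "'a::{field,finite}"
  assumes "r dvd CARD('a)"
  shows "(x + y) ^ r = x ^ r + y ^ r"
proof -
  have prime: "prime CHAR('a)"
    using finite_imp_CHAR_pos[where ?'a = 'a] prime_CHAR_semidom[where ?'a = 'a] by simp
  have "r \<noteq> 0"
    using assms by (intro notI) simp
  have "p = CHAR('a)" if "p \<in> prime_factors r" for p
    using that assms by (intro prime_dvd_CARD_eq_CHAR) (auto simp: in_prime_factors_iff intro: dvd_trans)
  then obtain n where "r = CHAR('a) ^ n"
    using Ex_other_prime_factor[OF \<open>r \<noteq> 0\<close> _ prime] by auto
  then show ?thesis
    using prime by (rule freshmans_dream'[rotated])
qed

text \<open>Multiplication by a nonzero \<open>x\<close> permutes the nonzero elements; cancelling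
  their product leaves \<open>x ^ (CARD('a) - 1) = 1\<close>.\<close>

lemma power_CARD_eq_same:
  fixes x :: "'a::{field,finite}"
  shows "x ^ CARD('a) = x"
proof (cases "x = 0")
  case False
  have "bij_betw ((*) x) (UNIV - {0}) (UNIV - {0})"
    by (rule bij_betw_byWitness[of _ "\<lambda>y. y / x"]) (use False in auto)
  then have "(\<Prod>y\<in>UNIV - {0}. x * y) = \<Prod>(UNIV - {0})"
    by (rule prod.reindex_bij_betw)
  then have "x ^ (CARD('a) - 1) = 1"
    by (simp add: prod.distrib)
  then have "x ^ Suc (CARD('a) - 1) = x"
    by (simp only: power_Suc mult_1_right)
  also have "Suc (CARD('a) - 1) = CARD('a)"
    by (intro Suc_diff_1) (simp add: card_gt_0_iff)
  finally show ?thesis .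
qed (simp add: card_gt_0_iff)

text \<open>Counting: each fibre of the additive map \<open>T\<close> is no larger than its kernel,
  whose elements are roots of a polynomial of degree \<open>r\<close>. As the field has
  \<open>r\<^sup>2\<close> elements, the range of \<open>T\<close> has at least \<open>r\<close>. It
  lies in the set of fixed points of the \<open>r\<close>-th power, which has at most
  \<open>r\<close> elements for the same reason, so the two sets agree.\<close>

lemma trace_surj:
  fixes c :: "'a::{field,finite}"
  assumes r: "r\<^sup>2 = CARD('a)" and c: "c ^ r = c"
  shows "\<exists>a. a + a ^ r = c"
proof -
  define T where "T = (\<lambda>a :: 'a. a + a ^ r)"
  have "r > 1"
  proof (rule ccontr)
    assume "\<not> r > 1"
    then have "r = 0 \<or> r = 1"
      by auto
    with r have "CARD('a) \<le> 1"
      by auto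
    then show False
      using card_mono[of UNIV "{0, 1 :: 'a}"] by simp
  qed
  have add: "(a + b) ^ r = a ^ r + b ^ r" for a b :: 'a
    using r by (intro power_add_of_dvd_CARD) (simp flip: r add: power2_eq_square)
  have T_add: "T (a - b) = 0" if "T a = T b" for a b
    using add[of "a - b" b] that by (simp add: T_def algebra_simps)
  have card_roots: "card {a :: 'a. poly p a = 0} \<le> r" if "p = monom 1 r + [:0, s:]" for p s
  proof -
    have "degree p = r"
      using that \<open>r > 1\<close> by (subst that, subst degree_add_eq_left) (auto simp: degree_monom_eq)
    then show ?thesis
      using card_poly_roots_bound[of p] \<open>r > 1\<close> by force
  qed
  have kernel: "card {a. T a = 0} \<le> r"
    using card_roots[of _ 1] by (simp add: T_def poly_monom add.commute)
  have fixed: "card {c :: 'a. c ^ r = c} \<le> r"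
    using card_roots[of _ "-1"] by (simp add: poly_monom)
  have "CARD('a) \<le> (\<Sum>b\<in>range T. card (T -` {b}))"
  proof -
    have "(\<Union>b\<in>range T. T -` {b}) = UNIV"
      by auto
    then show ?thesis
      using card_UN_le[of "range T" "\<lambda>b. T -` {b}"] by simp
  qed
  also have "\<dots> \<le> (\<Sum>b\<in>range T. r)"
  proof (rule sum_mono)
    fix b assume "b \<in> range T"
    then obtain a where a: "b = T a" by auto
    have "card (T -` {b}) \<le> card {a. T a = 0}"
      using T_add a by (intro card_inj_on_le[of "\<lambda>x. x - a"]) auto
    then show "card (T -` {b}) \<le> r"
      using kernel by simp
  qed
  finally have "r * r \<le> card (range T) * r"
    using r by (simp add: power2_eq_square)
  then have "card (range T) \<ge> r"
    using \<open>r > 1\<close> by simp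
  moreover have "range T \<subseteq> {c. c ^ r = c}"
  proof safe
    fix a :: 'a
    have "(a ^ r) ^ r = a"
      using power_CARD_eq_same[of a] r by (simp add: power2_eq_square flip: power_mult)
    then show "T a ^ r = T a"
      using add by (simp add: T_def add.commute)
  qed
  ultimately have "range T = {c. c ^ r = c}"
    using fixed by (intro card_seteq) auto
  then show ?thesis
    using c unfolding T_def by (metis (mono_tags, lifting) mem_Collect_eq rangeE)
qed

section \<open>Orthogonality in classical polar spaces\<close>

text \<open>
  \<open>Sg\<close> is the set of singular vectors, which is the whole space in the symplectic case. In the unitary
  case \<open>Sg_reach\<close> rests on the surjectivity of the trace map \<open>a \<mapsto> a + a\<^sup>r\<close>.
\<close>

locale polar_perp =
  fixes \<P> :: "('a::field ^ 'n::finite) set set"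
    and Sg :: "('a ^ 'n) set"
    and orth :: "'a ^ 'n \<Rightarrow> 'a ^ 'n \<Rightarrow> bool"  (infix "\<perp>" 50)
  assumes mem_iff: "S \<in> \<P> \<longleftrightarrow> vec.subspace S \<and> S \<subseteq> Sg \<and> (\<forall>x\<in>S. \<forall>y\<in>S. x \<perp> y)"
    and orth_sym: "x \<perp> y \<Longrightarrow> y \<perp> x"
    and orth_zero: "x \<perp> 0"
    and orth_add: "x \<perp> y \<Longrightarrow> x \<perp> y' \<Longrightarrow> x \<perp> y + y'"
    and orth_scale: "x \<perp> y \<Longrightarrow> x \<perp> c *s y"
    and orth_codim: "\<not> x \<perp> u \<Longrightarrow> \<exists>c. x \<perp> v - c *s u"
    and Sg_zero: "0 \<in> Sg"
    and Sg_scale: "x \<in> Sg \<Longrightarrow> c *s x \<in> Sg"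
    and Sg_add: "x \<in> Sg \<Longrightarrow> y \<in> Sg \<Longrightarrow> x \<perp> y \<Longrightarrow> x + y \<in> Sg"
    and Sg_self: "x \<in> Sg \<Longrightarrow> x \<perp> x"
    and Sg_reach: "w \<in> Sg \<Longrightarrow> \<not> w \<perp> v \<Longrightarrow> \<exists>c. v + c *s w \<in> Sg"
    and nondegenerate: "x \<in> Sg \<Longrightarrow> (\<And>v. x \<perp> v) \<Longrightarrow> x = 0"

text \<open>A totally singular subspace is totally orthogonal by polarization. Nondegeneracy is
  asked of singular vectors only: in odd dimension and characteristic 2 the radical of
  \<open>B\<close> is nonzero, but 0 is its only singular vector.\<close>

lemma polar_perp_quadratic:
  fixes Q :: "'a::field ^ 'n::finite \<Rightarrow> 'a" and B :: "'a ^ 'n \<Rightarrow> 'a ^ 'n \<Rightarrow> 'a"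
  assumes polar: "\<And>x y. Q (x + y) = Q x + Q y + B x y"
    and Q_scale: "\<And>c x. Q (c *s x) = c\<^sup>2 * Q x"
    and B_add: "\<And>x y y'. B x (y + y') = B x y + B x y'"
    and B_scale: "\<And>x c y. B x (c *s y) = c * B x y"
    and nondeg: "\<And>x. Q x = 0 \<Longrightarrow> (\<And>v. B x v = 0) \<Longrightarrow> x = 0"
  shows "polar_perp (totally_singular Q) {x. Q x = 0} (\<lambda>x y. B x y = 0)"
proof
  have B_sym: "B x y = B y x" for x y
    using polar[of x y] polar[of y x] by (simp add: add.commute)
  have B_diff: "B x (y - y') = B x y - B x y'" for x y y'
    using B_add[of x "y - y'" y'] by simp
  have Q0: "Q 0 = 0"
    using Q_scale[of 0 0] by simp
  show "S \<in> totally_singular Q \<longleftrightarrow> vec.subspace S \<and> S \<subseteq> {x. Q x = 0} \<and> (\<forall>x\<in>S. \<forall>y\<in>S. B x y = 0)" for S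
  proof -
    have "B x y = 0" if "vec.subspace S" "\<forall>x\<in>S. Q x = 0" "x \<in> S" "y \<in> S" for x y
      using polar[of x y] that by (simp add: vec.subspace_add)
    then show ?thesis
      by (auto simp: totally_singular_def)
  qed
  show "B x y = 0 \<Longrightarrow> B y x = 0" for x y
    using B_sym by simp
  show "B x 0 = 0" for x
    using B_scale[of x 0 0] by simp
  show "B x y = 0 \<Longrightarrow> B x y' = 0 \<Longrightarrow> B x (y + y') = 0" for x y y'
    using B_add by simp
  show "B x y = 0 \<Longrightarrow> B x (c *s y) = 0" for x y c
    using B_scale by simp
  show "\<exists>c. B x (v - c *s u) = 0" if "B x u \<noteq> 0" for x u v
    using that by (intro exI[of _ "B x v / B x u"]) (simp add: B_diff B_scale)
  show "0 \<in> {x. Q x = 0}"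
    using Q0 by simp
  show "x \<in> {x. Q x = 0} \<Longrightarrow> c *s x \<in> {x. Q x = 0}" for x c
    by (simp add: Q_scale)
  show "x \<in> {x. Q x = 0} \<Longrightarrow> y \<in> {x. Q x = 0} \<Longrightarrow> B x y = 0 \<Longrightarrow> x + y \<in> {x. Q x = 0}" for x y
    by (simp add: polar)
  show "x \<in> {x. Q x = 0} \<Longrightarrow> B x x = 0" for x
  proof -
    \<comment> \<open>For singular \<open>x\<close> both \<open>Q x\<close> and
      \<open>Q (2 *s x)\<close> vanish, so polarization at \<open>x + x\<close> gives
      \<open>B x x = 0\<close> in every characteristic.\<close>
    have "x + x = 2 *s x"
      by (metis one_add_one vec.scale_left_distrib vec.scale_one)
    then show "x \<in> {x. Q x = 0} \<Longrightarrow> B x x = 0"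
      using polar[of x x] Q_scale[of 2 x] by simp
  qed
  \<comment> \<open>Since \<open>Q w = 0\<close>, \<open>Q (v + c *s w) = Q v + c * B w v\<close> is
    linear in \<open>c\<close>.\<close>
  show "\<exists>c. v + c *s w \<in> {x. Q x = 0}" if "w \<in> {x. Q x = 0}" "B w v \<noteq> 0" for v w
    using that B_sym[of v w]
    by (intro exI[of _ "- Q v / B w v"]) (simp add: polar Q_scale B_scale del: vec.scale_minus_left)
  show "x = 0" if "x \<in> {x. Q x = 0}" "\<And>v. B x v = 0" for x
    using nondeg that by simp
qed

lemma polar_perp_alternating:
  fixes B :: "'a::field ^ 'n::finite \<Rightarrow> 'a ^ 'n \<Rightarrow> 'a"
  assumes alt: "\<And>x. B x x = 0" and B_sym: "\<And>x y. B y x = - B x y"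
    and B_add: "\<And>x y y'. B x (y + y') = B x y + B x y'"
    and B_scale: "\<And>x c y. B x (c *s y) = c * B x y"
    and nondeg: "\<And>x. (\<And>v. B x v = 0) \<Longrightarrow> x = 0"
  shows "polar_perp (totally_isotropic B) UNIV (\<lambda>x y. B x y = 0)"
proof
  have B_diff: "B x (y - y') = B x y - B x y'" for x y y'
    using B_add[of x "y - y'" y'] by simp
  show "\<exists>c. B x (v - c *s u) = 0" if "B x u \<noteq> 0" for x u v
    using that by (intro exI[of _ "B x v / B x u"]) (simp add: B_diff B_scale)
  show "B x 0 = 0" for x
    using B_scale[of x 0 0] by simp
  show "B x y = 0 \<Longrightarrow> B y x = 0" for x y
    using B_sym[of x y] by simp
  show "x = 0" if "\<And>v. B x v = 0" for x
    using nondeg that by simp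
qed (auto simp: totally_isotropic_def alt B_add B_scale)

text \<open>The \<open>r\<close>-th power is an involutory field automorphism, so \<open>h\<close>
  is linear in its first argument, semilinear in its second, and Hermitian.\<close>

lemma polar_perp_hermitian:
  fixes r :: nat
  defines "h \<equiv> \<lambda>(x :: 'a::{field,finite} ^ 'n::finite) y. \<Sum>i\<in>UNIV. x $ i * (y $ i) ^ r"
  assumes r: "r\<^sup>2 = CARD('a)"
  shows "polar_perp (totally_isotropic h) {x. h x x = 0} (\<lambda>x y. h x y = 0)"
proof -
  have add: "(a + b) ^ r = a ^ r + b ^ r" for a b :: 'a
    using r by (intro power_add_of_dvd_CARD) (simp flip: r add: power2_eq_square)
  have rr: "(a ^ r) ^ r = a" for a :: 'a
    using power_CARD_eq_same[of a] r by (simp add: power2_eq_square flip: power_mult)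
  have r0: "r > 0"
    using r by (intro gr0I) simp
  have sum: "(\<Sum>i\<in>I. f i) ^ r = (\<Sum>i\<in>I. f i ^ r)" for f :: "'n \<Rightarrow> 'a" and I
    by (induction I rule: infinite_finite_induct) (use r0 in \<open>auto simp: add\<close>)
  have h_sym: "h y x = h x y ^ r" for x y
    by (simp add: h_def sum power_mult_distrib rr mult.commute)
  have h_add: "h x (y + y') = h x y + h x y'" "h (y + y') x = h y x + h y' x" for x y y'
    by (simp_all add: h_def add algebra_simps sum.distrib)
  have h_scale: "h x (c *s y) = c ^ r * h x y" "h (c *s y) x = c * h y x" for x c y
    by (simp_all add: h_def power_mult_distrib sum_distrib_left mult_ac)
  have h_diff: "h x (y - y') = h x y - h x y'" for x y y'
    using h_add(1)[of x "y - y'" y'] by simp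
  have h_zero: "h x 0 = 0" for x
    using r0 by (simp add: h_def zero_power)
  have orth_sym: "h x y = 0 \<Longrightarrow> h y x = 0" for x y
    using h_sym[of y x] r0 by simp
  show ?thesis
  proof
    show "\<exists>c. h x (v - c *s u) = 0" if "h x u \<noteq> 0" for x u v
    proof -
      \<comment> \<open>The scalar is taken as \<open>c ^ r\<close> because semilinearity turns it
        into \<open>(c ^ r) ^ r = c\<close>.\<close>
      have "h x (v - (c ^ r) *s u) = h x v - c * h x u" for c
        by (simp only: h_diff h_scale rr)
      then show ?thesis
        using that by (metis diff_self nonzero_eq_divide_eq)
    qed
    show "\<exists>c. v + c *s w \<in> {x. h x x = 0}" if "w \<in> {x. h x x = 0}" "h w v \<noteq> 0" for v w
    proof -
      have "h v v ^ r = h v v"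
        by (rule h_sym[symmetric])
      \<comment> \<open>The value \<open>- h v v\<close> is fixed by the automorphism, hence a trace
        \<open>a + a ^ r\<close>. Scaling \<open>w\<close> by \<open>a / h w v\<close> makes the two
        cross terms \<open>a\<close> and \<open>a ^ r\<close>.\<close>
      then have "(- h v v) ^ r = - h v v"
        using add[of "h v v" "- h v v"] r0 by (simp add: zero_power eq_neg_iff_add_eq_0 add.commute)
      then obtain a where a: "a + a ^ r = - h v v"
        using trace_surj[OF r] by blast
      have "h (v + (a / h w v) *s w) (v + (a / h w v) *s w) = h v v + a + a ^ r"
        using that h_sym[of v w] rr[of "h w v"] by (simp add: h_add h_scale power_divide)
      then show ?thesis
        using a by (intro exI[of _ "a / h w v"]) (simp add: add.assoc)
    qed
    show "x = 0" if "\<And>v. h x v = 0" for x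
    proof -
      have "x $ i = 0" for i
      proof -
        have "h x (axis i 1) = (\<Sum>j\<in>UNIV. if j = i then x $ i else 0)"
          unfolding h_def by (rule sum.cong) (use r0 in \<open>auto simp: axis_def\<close>)
        then show ?thesis
          using that by simp
      qed
      then show ?thesis
        by (simp add: vec_eq_iff)
    qed
  qed (auto simp: totally_isotropic_def h_add h_scale h_zero orth_sym)
qed

text \<open>A nontrivial zero \<open>(u, v)\<close> would split off a linear factor:
  \<open>X\<^sub>2\<close> if \<open>v = 0\<close>, and \<open>X\<^sub>1 - t X\<^sub>2\<close> with
  \<open>t = u / v\<close> otherwise. Irreducibility thus makes the binary form anisotropic.\<close>

lemma irreducible_homogeneous_quadraticE:
  fixes f :: "'a::field poly poly"
  assumes hom: "homogeneous_quadratic f" and irr: "irreducible f"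
  obtains \<alpha> \<beta> \<gamma> where "\<And>u v. eval2 f u v = \<alpha> * u\<^sup>2 + \<beta> * u * v + \<gamma> * v\<^sup>2"
    and "\<And>u v. \<alpha> * u\<^sup>2 + \<beta> * u * v + \<gamma> * v\<^sup>2 = 0 \<Longrightarrow> u = 0 \<and> v = 0"
proof -
  define \<alpha> \<beta> \<gamma> where "\<alpha> = coeff (coeff f 2) 0" and "\<beta> = coeff (coeff f 1) 1" and "\<gamma> = coeff (coeff f 0) 2"
  have coeffs: "coeff (coeff f i) j = 0" if "i + j \<noteq> 2" for i j
    using hom that by (auto simp: homogeneous_quadratic_def)
  have f: "f = [:[:0, 0, \<gamma>:], [:0, \<beta>:], [:\<alpha>:]:]"
  proof (intro poly_eqI)
    fix i j
    show "coeff (coeff f i) j = coeff (coeff [:[:0, 0, \<gamma>:], [:0, \<beta>:], [:\<alpha>:]:] i) j"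
    proof (cases "i + j = 2")
      case True
      then consider "i = 0" "j = 2" | "i = 1" "j = 1" | "i = 2" "j = 0"
        by linarith
      then show ?thesis
        by cases (simp_all add: \<alpha>_def \<beta>_def \<gamma>_def numeral_2_eq_2)
    qed (simp add: coeffs coeff_pCons split: nat.split)
  qed
  have not_linear: "\<not> [:a, b:] dvd 1" if "b \<noteq> 0" for a b :: 'a
    using that by (auto simp: is_unit_poly_iff)
  have not_unit: "\<not> [:[:0, b:], c:] dvd 1" for b :: 'a and c
    by (auto simp: is_unit_poly_iff)
  have "u = 0 \<and> v = 0" if zero: "\<alpha> * u\<^sup>2 + \<beta> * u * v + \<gamma> * v\<^sup>2 = 0" for u v
  proof (rule ccontr)
    assume ne: "\<not> (u = 0 \<and> v = 0)"
    show False
    proof (cases "v = 0")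
      case True
      then have "f = [:[:0, 1:]:] * [:[:0, \<gamma>:], [:\<beta>:]:]"
        using zero ne f by simp
      from irreducibleD[OF irr this] show False
        using not_unit[of \<gamma> "[:\<beta>:]"] not_linear[of 1 0] by (simp add: is_unit_const_poly_iff)
    next
      case False
      define t where "t = u / v"
      have "u = t * v"
        using False by (simp add: t_def)
      then have "(\<alpha> * t * t + \<beta> * t + \<gamma>) * (v * v) = 0"
        using zero by (simp add: power2_eq_square algebra_simps)
      then have "\<alpha> * t * t + \<beta> * t + \<gamma> = 0"
        using False by simp
      then have "\<gamma> = - t * (\<beta> + \<alpha> * t)"
        by (simp add: eq_neg_iff_add_eq_0 algebra_simps)
      then have "f = [:[:0, - t:], 1:] * [:[:0, \<beta> + \<alpha> * t:], [:\<alpha>:]:]"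
        using f by (simp add: algebra_simps)
      from irreducibleD[OF irr this] show False
        using not_unit by blast
    qed
  qed
  moreover have "eval2 f u v = \<alpha> * u\<^sup>2 + \<beta> * u * v + \<gamma> * v\<^sup>2" for u v
    by (simp add: f eval2_def power2_eq_square algebra_simps)
  ultimately show ?thesis
    using that by blast
qed

text \<open>The coordinates \<open>s i\<close> and \<open>t i\<close> form hyperbolic pairs, and
  pairing with the unit vector of one reads off the other. The sign \<epsilon> is 1 for quadratic
  forms and -1 for the symplectic form.\<close>

lemma hyperbolic_axis:
  fixes s t :: "nat \<Rightarrow> 'n::finite" and x :: "'a::field ^ 'n"
  assumes inj: "inj_on s I" "inj_on t I" and disj: "s ` I \<inter> t ` I = {}" and "finite I" and j: "j \<in> I"
  shows "(\<Sum>i\<in>I. x $ s i * axis (t j) 1 $ t i + \<epsilon> * (x $ t i * axis (t j) 1 $ s i)) = x $ s j"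
    and "(\<Sum>i\<in>I. x $ s i * axis (s j) 1 $ t i + \<epsilon> * (x $ t i * axis (s j) 1 $ s i)) = \<epsilon> * x $ t j"
proof -
  have "s i = s j \<longleftrightarrow> i = j" "t i = t j \<longleftrightarrow> i = j" "s i \<noteq> t j" "t i \<noteq> s j" if "i \<in> I" for i
    using inj disj j that by (auto simp: inj_on_eq_iff)
  then have "(\<Sum>i\<in>I. x $ s i * axis (t j) 1 $ t i + \<epsilon> * (x $ t i * axis (t j) 1 $ s i))
      = (\<Sum>i\<in>I. if i = j then x $ s j else 0)"
    and "(\<Sum>i\<in>I. x $ s i * axis (s j) 1 $ t i + \<epsilon> * (x $ t i * axis (s j) 1 $ s i))
      = (\<Sum>i\<in>I. if i = j then \<epsilon> * x $ t j else 0)"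
    by (auto intro!: sum.cong simp: axis_def)
  then show "(\<Sum>i\<in>I. x $ s i * axis (t j) 1 $ t i + \<epsilon> * (x $ t i * axis (t j) 1 $ s i)) = x $ s j"
    and "(\<Sum>i\<in>I. x $ s i * axis (s j) 1 $ t i + \<epsilon> * (x $ t i * axis (s j) 1 $ s i)) = \<epsilon> * x $ t j"
    using \<open>finite I\<close> j by simp_all
qed

text \<open>Common core of the three orthogonal types, with \<open>g\<close> being \<open>0\<close>,
  \<open>x\<^sub>1\<^sup>2\<close> or the irreducible binary form. A singular vector orthogonal to
  everything has zero hyperbolic coordinates; then \<open>g\<close> vanishes on it too, and
  anisotropy makes the vector zero.\<close>

lemma polar_perp_hyperbolic_sum:
  fixes g :: "'a::field ^ 'n::finite \<Rightarrow> 'a" and s t :: "nat \<Rightarrow> 'n"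
  assumes inj: "inj_on s I" "inj_on t I" and disj: "s ` I \<inter> t ` I = {}" and fin: "finite I"
    and polar: "\<And>x y. g (x + y) = g x + g y + b x y"
    and g_scale: "\<And>c x. g (c *s x) = c\<^sup>2 * g x"
    and b_add: "\<And>x y y'. b x (y + y') = b x y + b x y'"
    and b_scale: "\<And>x c y. b x (c *s y) = c * b x y"
    and b_axis: "\<And>x i. i \<in> I \<Longrightarrow> b x (axis (s i) 1) = 0 \<and> b x (axis (t i) 1) = 0"
    and aniso: "\<And>x. g x = 0 \<Longrightarrow> (\<And>i. i \<in> I \<Longrightarrow> x $ s i = 0 \<and> x $ t i = 0) \<Longrightarrow> x = 0"
  shows "\<exists>Sg orth. polar_perp (totally_singular (\<lambda>x. g x + (\<Sum>i\<in>I. x $ s i * x $ t i))) Sg orth"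
proof -
  \<comment> \<open>The factor \<open>1\<close> matches the shape of \<open>hyperbolic_axis\<close>
    with \<open>\<epsilon> = 1\<close>.\<close>
  let ?B = "\<lambda>x y. b x y + (\<Sum>i\<in>I. x $ s i * y $ t i + 1 * (x $ t i * y $ s i))"
  have "polar_perp (totally_singular (\<lambda>x. g x + (\<Sum>i\<in>I. x $ s i * x $ t i)))
      {x. g x + (\<Sum>i\<in>I. x $ s i * x $ t i) = 0} (\<lambda>x y. ?B x y = 0)"
  proof (rule polar_perp_quadratic)
    show "x = 0" if Q: "g x + (\<Sum>i\<in>I. x $ s i * x $ t i) = 0" and B: "\<And>v. ?B x v = 0" for x
    proof -
      have zero: "x $ s i = 0 \<and> x $ t i = 0" if "i \<in> I" for i
        using B[of "axis (s i) 1"] B[of "axis (t i) 1"] b_axis[OF that]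
          hyperbolic_axis[OF inj disj fin that, of x 1]
        by simp
      then have "g x = 0"
        using Q by simp
      with zero show ?thesis
        using aniso by blast
    qed
  qed (simp_all add: polar g_scale b_add b_scale sum.distrib sum_distrib_left algebra_simps power2_eq_square)
  then show ?thesis
    by blast
qed

lemma vec_zero_of_enumeration:
  fixes x :: "'a::zero ^ 'n"
  assumes "bij_betw c K (UNIV :: 'n set)" "\<And>k. k \<in> K \<Longrightarrow> x $ c k = 0"
  shows "x = 0"
proof -
  have "x $ i = 0" for i
    using assms bij_betw_imp_surj_on[OF assms(1)] by (metis UNIV_I imageE)
  then show ?thesis
    by (simp add: vec_eq_iff)
qed

lemma classical_polar_space_polar_perp:
  assumes "classical_polar_space d e (\<P> :: ('a::{field,finite} ^ 'n::finite) set set)"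
  shows "\<exists>Sg orth. polar_perp \<P> Sg orth"
  using assms
proof cases
  case (O_plus c)
  have c: "c k = c k' \<longleftrightarrow> k = k'" if "k \<in> {1..2*d}" "k' \<in> {1..2*d}" for k k'
    using O_plus(4) that by (auto simp: bij_betw_def inj_on_eq_iff)
  have inj: "inj_on (\<lambda>i. c (2*i - 1)) {1..d}" "inj_on (\<lambda>i. c (2*i)) {1..d}"
    by (rule inj_onI, drule c[THEN iffD1, rotated 2]; auto)+
  have "c (2*i - 1) \<noteq> c (2*j)" if "i \<in> {1..d}" "j \<in> {1..d}" for i j
  proof -
    have "2*i - 1 \<noteq> 2*j \<and> 2*i - 1 \<in> {1..2*d} \<and> 2*j \<in> {1..2*d}"
      using that unfolding atLeastAtMost_iff by presburger
    then show ?thesis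
      using c by blast
  qed
  then have disj: "(\<lambda>i. c (2*i - 1)) ` {1..d} \<inter> (\<lambda>i. c (2*i)) ` {1..d} = {}"
    by blast
  have "\<exists>Sg orth. polar_perp (totally_singular (\<lambda>x :: 'a ^ 'n.
      0 + (\<Sum>i=1..d. x $ c (2*i - 1) * x $ c (2*i)))) Sg orth"
  proof (rule polar_perp_hyperbolic_sum[OF inj disj, where b = "\<lambda>_ _. 0"])
    fix x :: "'a ^ 'n"
    assume zero: "\<And>i. i \<in> {1..d} \<Longrightarrow> x $ c (2*i - 1) = 0 \<and> x $ c (2*i) = 0"
    show "x = 0"
    proof (rule vec_zero_of_enumeration[OF O_plus(4)])
      fix k assume "k \<in> {1..2*d}"
      then have "\<exists>i\<in>{1..d}. k = 2*i - 1 \<or> k = 2*i"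
        unfolding Bex_def atLeastAtMost_iff by presburger
      then show "x $ c k = 0"
        using zero by blast
    qed
  qed (simp_all)
  then show ?thesis
    using O_plus by simp
next
  case (O_odd c)
  have c: "c k = c k' \<longleftrightarrow> k = k'" if "k \<in> {1..2*d + 1}" "k' \<in> {1..2*d + 1}" for k k'
    using O_odd(4) that by (auto simp: bij_betw_def inj_on_eq_iff)
  have inj: "inj_on (\<lambda>i. c (2*i)) {1..d}" "inj_on (\<lambda>i. c (2*i + 1)) {1..d}"
    by (rule inj_onI, drule c[THEN iffD1, rotated 2]; auto)+
  have "c (2*i) \<noteq> c (2*j + 1)" if "i \<in> {1..d}" "j \<in> {1..d}" for i j
  proof -
    have "2*i \<noteq> 2*j + 1 \<and> 2*i \<in> {1..2*d + 1} \<and> 2*j + 1 \<in> {1..2*d + 1}"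
      using that unfolding atLeastAtMost_iff by presburger
    then show ?thesis
      using c by blast
  qed
  then have disj: "(\<lambda>i. c (2*i)) ` {1..d} \<inter> (\<lambda>i. c (2*i + 1)) ` {1..d} = {}"
    by blast
  have "\<exists>Sg orth. polar_perp (totally_singular (\<lambda>x :: 'a ^ 'n.
      (x $ c 1)\<^sup>2 + (\<Sum>i=1..d. x $ c (2*i) * x $ c (2*i + 1)))) Sg orth"
  \<comment> \<open>The polar form of \<open>x\<^sub>1\<^sup>2\<close> is zero in characteristic 2,
    so the first coordinate is controlled by \<open>g\<close>, not by orthogonality.\<close>
  proof (rule polar_perp_hyperbolic_sum[OF inj disj, where b = "\<lambda>x y. 2 * x $ c 1 * y $ c 1"])
    fix x :: "'a ^ 'n"
    assume "(x $ c 1)\<^sup>2 = 0"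
      and zero: "\<And>i. i \<in> {1..d} \<Longrightarrow> x $ c (2*i) = 0 \<and> x $ c (2*i + 1) = 0"
    show "x = 0"
    proof (rule vec_zero_of_enumeration[OF O_odd(4)])
      fix k assume "k \<in> {1..2*d + 1}"
      then have "k = 1 \<or> (\<exists>i\<in>{1..d}. k = 2*i \<or> k = 2*i + 1)"
        unfolding Bex_def atLeastAtMost_iff by presburger
      then show "x $ c k = 0"
        using zero \<open>(x $ c 1)\<^sup>2 = 0\<close> by auto
    qed
  qed (auto simp: c axis_def power2_eq_square algebra_simps)
  then show ?thesis
    using O_odd by simp
next
  case (O_minus c f)
  obtain \<alpha> \<beta> \<gamma> where f: "\<And>u v. eval2 f u v = \<alpha> * u\<^sup>2 + \<beta> * u * v + \<gamma> * v\<^sup>2"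
    and aniso: "\<And>u v. \<alpha> * u\<^sup>2 + \<beta> * u * v + \<gamma> * v\<^sup>2 = 0 \<Longrightarrow> u = 0 \<and> v = 0"
    using irreducible_homogeneous_quadraticE O_minus by blast
  have c: "c k = c k' \<longleftrightarrow> k = k'" if "k \<in> {1..2*d + 2}" "k' \<in> {1..2*d + 2}" for k k'
    using O_minus(4) that by (auto simp: bij_betw_def inj_on_eq_iff)
  have inj: "inj_on (\<lambda>i. c (2*i + 1)) {1..d}" "inj_on (\<lambda>i. c (2*i + 2)) {1..d}"
    by (rule inj_onI, drule c[THEN iffD1, rotated 2]; auto)+
  have "c (2*i + 1) \<noteq> c (2*j + 2)" if "i \<in> {1..d}" "j \<in> {1..d}" for i j
  proof -
    have "2*i + 1 \<noteq> 2*j + 2 \<and> 2*i + 1 \<in> {1..2*d + 2} \<and> 2*j + 2 \<in> {1..2*d + 2}"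
      using that unfolding atLeastAtMost_iff by presburger
    then show ?thesis
      using c by blast
  qed
  then have disj: "(\<lambda>i. c (2*i + 1)) ` {1..d} \<inter> (\<lambda>i. c (2*i + 2)) ` {1..d} = {}"
    by blast
  have "\<exists>Sg orth. polar_perp (totally_singular (\<lambda>x :: 'a ^ 'n.
      eval2 f (x $ c 1) (x $ c 2) + (\<Sum>i=1..d. x $ c (2*i + 1) * x $ c (2*i + 2)))) Sg orth"
  proof (rule polar_perp_hyperbolic_sum[OF inj disj, where b = "\<lambda>x y. 2 * \<alpha> * x $ c 1 * y $ c 1
        + \<beta> * (x $ c 1 * y $ c 2 + x $ c 2 * y $ c 1) + 2 * \<gamma> * x $ c 2 * y $ c 2"])
    fix x :: "'a ^ 'n"
    assume eval2: "eval2 f (x $ c 1) (x $ c 2) = 0"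
      and zero: "\<And>i. i \<in> {1..d} \<Longrightarrow> x $ c (2*i + 1) = 0 \<and> x $ c (2*i + 2) = 0"
    have "x $ c 1 = 0 \<and> x $ c 2 = 0"
      by (rule aniso) (use eval2 f in simp)
    show "x = 0"
    proof (rule vec_zero_of_enumeration[OF O_minus(4)])
      fix k assume "k \<in> {1..2*d + 2}"
      \<comment> \<open>The number \<open>(k - 1) div 2\<close> is the index of the hyperbolic pair
        to which coordinate \<open>k\<close> belongs.\<close>
      then have "k = 1 \<or> k = 2 \<or> (k - 1) div 2 \<in> {1..d} \<and>
          (k = 2 * ((k - 1) div 2) + 1 \<or> k = 2 * ((k - 1) div 2) + 2)"
        unfolding atLeastAtMost_iff by presburger
      then show "x $ c k = 0"
        using zero \<open>x $ c 1 = 0 \<and> x $ c 2 = 0\<close> by metis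
    qed
  qed (auto simp: c axis_def f power2_eq_square algebra_simps)
  then show ?thesis
    using O_minus by simp
next
  case (Sp c)
  \<comment> \<open>Written with \<open>+ - 1\<close> so that \<open>hyperbolic_axis\<close> applies
    with \<open>\<epsilon> = - 1\<close>.\<close>
  let ?B = "\<lambda>x y :: 'a ^ 'n. \<Sum>i=1..d. x $ c (2*i - 1) * y $ c (2*i) + - 1 * (x $ c (2*i) * y $ c (2*i - 1))"
  have c: "c k = c k' \<longleftrightarrow> k = k'" if "k \<in> {1..2*d}" "k' \<in> {1..2*d}" for k k'
    using Sp(4) that by (auto simp: bij_betw_def inj_on_eq_iff)
  have inj: "inj_on (\<lambda>i. c (2*i - 1)) {1..d}" "inj_on (\<lambda>i. c (2*i)) {1..d}"
    by (rule inj_onI, drule c[THEN iffD1, rotated 2]; auto)+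
  have "c (2*i - 1) \<noteq> c (2*j)" if "i \<in> {1..d}" "j \<in> {1..d}" for i j
  proof -
    have "2*i - 1 \<noteq> 2*j \<and> 2*i - 1 \<in> {1..2*d} \<and> 2*j \<in> {1..2*d}"
      using that unfolding atLeastAtMost_iff by presburger
    then show ?thesis
      using c by blast
  qed
  then have disj: "(\<lambda>i. c (2*i - 1)) ` {1..d} \<inter> (\<lambda>i. c (2*i)) ` {1..d} = {}"
    by blast
  have "polar_perp (totally_isotropic ?B) UNIV (\<lambda>x y. ?B x y = 0)"
  proof (rule polar_perp_alternating)
    show "?B x (y + y') = ?B x y + ?B x y'" for x y y'
      by (simp add: algebra_simps flip: sum.distrib)
    fix x :: "'a ^ 'n"
    assume B: "\<And>v. ?B x v = 0"
    have zero: "x $ c (2*i - 1) = 0 \<and> x $ c (2*i) = 0" if "i \<in> {1..d}" for i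
      using B[of "axis (c (2*i - 1)) 1"] B[of "axis (c (2*i)) 1"]
        hyperbolic_axis[OF inj disj _ that, of x "- 1"]
      by simp
    show "x = 0"
    proof (rule vec_zero_of_enumeration[OF Sp(4)])
      fix k assume "k \<in> {1..2*d}"
      then have "\<exists>i\<in>{1..d}. k = 2*i - 1 \<or> k = 2*i"
        unfolding Bex_def atLeastAtMost_iff by presburger
      then show "x $ c k = 0"
        using zero by blast
    qed
  qed (simp_all add: algebra_simps sum.distrib sum_distrib_left flip: sum_negf)
  then show ?thesis
    using Sp by auto
next
  case (U_even r)
  then show ?thesis
    using polar_perp_hermitian by blast
next
  case (U_odd r)
  then show ?thesis
    using polar_perp_hermitian by blast
qed

context polar_perp
begin

lemma orth_commute: "x \<perp> y \<longleftrightarrow> y \<perp> x"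
  using orth_sym by blast

lemma orth_diff: "x \<perp> y \<Longrightarrow> x \<perp> y' \<Longrightarrow> x \<perp> y - y'"
  using orth_add[of x y "(- 1) *s y'"] orth_scale[of x y' "- 1"] by simp

lemma orth_span: "(\<And>t. t \<in> T \<Longrightarrow> x \<perp> t) \<Longrightarrow> y \<in> vec.span T \<Longrightarrow> x \<perp> y"
  by (rule vec.span_induct[of y T "\<lambda>y. x \<perp> y"])
    (auto simp: vec.subspace_def orth_zero orth_add orth_scale)

text \<open>\<open>Sg_add\<close> applies to orthogonal vectors only. So orthogonality is first
  spread over the span, one argument at a time, and singularity follows by induction.\<close>

lemma span_mem:
  assumes "T \<subseteq> Sg" and T: "\<And>x y. x \<in> T \<Longrightarrow> y \<in> T \<Longrightarrow> x \<perp> y"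
  shows "vec.span T \<in> \<P>"
proof -
  have "x \<perp> y" if "x \<in> T" "y \<in> vec.span T" for x y
    using orth_span T that by blast
  then have orth: "x \<perp> y" if "x \<in> vec.span T" "y \<in> vec.span T" for x y
    using orth_span[of T y x] orth_sym that by blast
  have "x \<in> vec.span T \<and> x \<in> Sg" if "x \<in> vec.span T" for x
    using that
  proof (induction rule: vec.span_induct_alt)
    case base
    show ?case
      using Sg_zero vec.span_zero by blast
  next
    case (step c x y)
    then have "c *s x \<in> vec.span T"
      by (simp add: vec.span_base vec.span_scale)
    with step show ?case
      using assms(1) orth by (auto intro!: Sg_add Sg_scale vec.span_add)
  qed
  then show ?thesis
    using orth by (auto simp: mem_iff vec.subspace_span)
qed

lemma mem_orth: "S \<in> \<P> \<Longrightarrow> x \<in> S \<Longrightarrow> y \<in> S \<Longrightarrow> x \<perp> y"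
  and mem_Sg: "S \<in> \<P> \<Longrightarrow> x \<in> S \<Longrightarrow> x \<in> Sg"
  and mem_subspace: "S \<in> \<P> \<Longrightarrow> vec.subspace S"
  by (auto simp: mem_iff)

lemma point_span: "v \<in> Sg \<Longrightarrow> v \<noteq> 0 \<Longrightarrow> vec.span {v} \<in> points \<P>"
  using Sg_self vec.dim_span_eq_card_independent[of "{v}"]
  by (auto simp: points_def intro!: span_mem)

lemma pointE:
  assumes "p \<in> points \<P>"
  obtains v where "v \<noteq> 0" "v \<in> Sg" "p = vec.span {v}"
proof -
  have p: "p \<in> \<P>" "vec.dim p = 1"
    using assms by (auto simp: points_def)
  obtain B where B: "B \<subseteq> p" "vec.independent B" "p \<subseteq> vec.span B" "card B = 1"
    using vec.basis_exists[of p] p by metis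
  then obtain v where "B = {v}"
    by (auto simp: card_1_singleton_iff)
  moreover have "vec.span B = p"
    using B mem_subspace[OF p(1)] by (metis vec.span_subspace)
  moreover have "v \<noteq> 0"
    using B(2) \<open>B = {v}\<close> vec.dependent_zero[of B] by blast
  moreover have "v \<in> Sg"
    using B(1) \<open>B = {v}\<close> mem_Sg[OF p(1)] by blast
  ultimately show ?thesis
    using that[of v] by blast
qed

lemma span_singleton_subset: "vec.subspace S \<Longrightarrow> vec.span {v} \<subseteq> S \<longleftrightarrow> v \<in> S"
  by (meson empty_subsetI insert_subset vec.span_base vec.span_minimal insertI1 subsetD)

lemma span_singleton_in_points_in:
  "S \<in> \<P> \<Longrightarrow> v \<in> Sg \<Longrightarrow> v \<noteq> 0 \<Longrightarrow> vec.span {v} \<in> points_in \<P> S \<longleftrightarrow> v \<in> S"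
  by (simp add: points_in_def point_span span_singleton_subset mem_subspace)

text \<open>The case \<open>v = 0\<close> is included: both sides are then false, since the zero
  space is not a point and 0 lies in \<open>L\<close>.\<close>

lemma span_singleton_in_affine_part:
  "L \<in> \<P> \<Longrightarrow> S \<in> \<P> \<Longrightarrow> v \<in> Sg \<Longrightarrow> vec.span {v} \<in> affine_part \<P> L S \<longleftrightarrow> v \<in> S - L"
proof (cases "v = 0")
  case True
  assume "S \<in> \<P>" "L \<in> \<P>"
  moreover have "vec.span {v} \<notin> points \<P>"
    using True vec.dim_empty by (auto simp: points_def)
  ultimately show ?thesis
    using True by (auto simp: affine_part_def points_in_def vec.subspace_0 mem_subspace)
qed (simp add: affine_part_def span_singleton_in_points_in)

lemma perp_iff:
  assumes S: "S \<in> \<P>" and p: "p \<in> points \<P>"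
  shows "p \<in> perp \<P> S \<longleftrightarrow> (\<forall>s\<in>S. \<forall>v\<in>p. s \<perp> v)"
proof
  have p': "p \<in> \<P>"
    using p by (simp add: points_def)
  assume "p \<in> perp \<P> S"
  then have "vec.span (S \<union> p) \<in> \<P>"
    by (simp add: perp_def)
  then show "\<forall>s\<in>S. \<forall>v\<in>p. s \<perp> v"
    using mem_orth by (meson UnI1 UnI2 vec.span_base)
next
  have p': "p \<in> \<P>"
    using p by (simp add: points_def)
  assume orth: "\<forall>s\<in>S. \<forall>v\<in>p. s \<perp> v"
  have "x \<perp> y" if "x \<in> S \<union> p" "y \<in> S \<union> p" for x y
    using that orth orth_sym mem_orth[OF S] mem_orth[OF p'] by blast
  then have "vec.span (S \<union> p) \<in> \<P>"
    using mem_Sg[OF S] mem_Sg[OF p'] by (intro span_mem) auto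
  then show "p \<in> perp \<P> S"
    using p by (simp add: perp_def)
qed

lemma span_singleton_perp_iff:
  assumes "S \<in> \<P>" "v \<in> Sg" "v \<noteq> 0"
  shows "vec.span {v} \<in> perp \<P> S \<longleftrightarrow> (\<forall>s\<in>S. s \<perp> v)"
proof -
  have "(\<forall>u\<in>vec.span {v}. s \<perp> u) \<longleftrightarrow> s \<perp> v" for s
    using orth_span[of "{v}" s] by (auto intro: vec.span_base)
  then show ?thesis
    using perp_iff[OF assms(1) point_span[OF assms(2,3)]] by simp
qed

lemma span_singletons_perp_iff:
  assumes "u \<in> Sg" "u \<noteq> 0" "v \<in> Sg" "v \<noteq> 0"
  shows "vec.span {v} \<in> perp \<P> (vec.span {u}) \<longleftrightarrow> u \<perp> v"
proof -
  have "vec.span {u} \<in> \<P>"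
    using point_span[OF assms(1,2)] by (simp add: points_def)
  moreover have "(\<forall>s\<in>vec.span {u}. s \<perp> v) \<longleftrightarrow> u \<perp> v"
    using orth_span[of "{u}" v] orth_commute by (auto intro: vec.span_base)
  ultimately show ?thesis
    using span_singleton_perp_iff assms by simp
qed

text \<open>This is \<open>{x, y}\<^sup>\<perp>\<^sup>\<perp> = \<langle>x, y\<rangle>\<close> for orthogonality restricted to singular vectors.\<close>

lemma separating_vector:
  assumes Sg: "x \<in> Sg" "y \<in> Sg" "w \<in> Sg" and orth: "x \<perp> y" "x \<perp> w" "y \<perp> w"
    and x: "x \<notin> vec.span {y}" and y: "y \<notin> vec.span {x}" and w: "w \<notin> vec.span {x, y}"
  shows "\<exists>v\<in>Sg. x \<perp> v \<and> y \<perp> v \<and> \<not> w \<perp> v"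
proof -
  \<comment> \<open>The analogue for one vector. If everything orthogonal to \<open>s\<close> were
    orthogonal to \<open>t\<close>, take \<open>u\<close> not orthogonal to \<open>s\<close> and
    \<open>c\<close> with \<open>u \<perp> t - c *s s\<close>. Each \<open>v\<close> is a multiple
    of \<open>u\<close> plus a vector orthogonal to \<open>s\<close>, hence to \<open>t\<close>; so
    \<open>t - c *s s\<close> is orthogonal to everything and vanishes.\<close>
  have pair: "\<exists>u. s \<perp> u \<and> \<not> t \<perp> u" if "s \<in> Sg" "t \<in> Sg" "s \<perp> t" "t \<notin> vec.span {s}" for s t
  proof (rule ccontr)
    assume *: "\<nexists>u. s \<perp> u \<and> \<not> t \<perp> u"
    have "s \<noteq> 0 \<or> t \<noteq> 0"
      using that(4) vec.span_zero by metis
    show False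
    proof (cases "\<forall>u. s \<perp> u")
      case True
      then have "t = 0"
        using * nondegenerate[OF that(2)] by blast
      then show False
        using that(4) vec.span_zero by metis
    next
      case False
      then obtain u where u: "\<not> s \<perp> u"
        by blast
      then have "\<not> u \<perp> s"
        using orth_sym by blast
      then obtain c where "u \<perp> t - c *s s"
        using orth_codim by blast
      have "t - c *s s \<perp> v" for v
      proof -
        obtain k where s: "s \<perp> v - k *s u"
          using orth_codim[OF u] by blast
        then have t: "t \<perp> v - k *s u"
          using * by blast
        have "v - k *s u \<perp> t - c *s s"
          by (rule orth_diff[OF orth_sym[OF t] orth_scale[OF orth_sym[OF s]]])
        from orth_add[OF orth_sym[OF this] orth_scale[OF orth_sym[OF \<open>u \<perp> t - c *s s\<close>]]]
        have "t - c *s s \<perp> (v - k *s u) + k *s u" .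
        then show ?thesis
          by simp
      qed
      moreover have "t - c *s s \<in> Sg"
      proof -
        have "t + (- c) *s s \<in> Sg"
          using that by (intro Sg_add Sg_scale orth_scale) (auto intro: orth_sym)
        then show ?thesis
          by simp
      qed
      ultimately have "t = c *s s"
        using nondegenerate[of "t - c *s s"] by simp
      then show False
        using that(4) by (simp add: vec.span_base vec.span_scale)
    qed
  qed
  \<comment> \<open>Up to scaling, \<open>u1\<close> and \<open>u2\<close> are dual to
    \<open>x\<close> and \<open>y\<close>.\<close>
  obtain u1 where u1: "y \<perp> u1" "\<not> x \<perp> u1"
    using pair[OF Sg(2,1)] orth_sym orth(1) x by blast
  obtain u2 where u2: "x \<perp> u2" "\<not> y \<perp> u2"
    using pair[OF Sg(1,2) orth(1) y] by blast
  have "\<exists>v. x \<perp> v \<and> y \<perp> v \<and> \<not> w \<perp> v"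
  proof (rule ccontr)
    assume *: "\<nexists>v. x \<perp> v \<and> y \<perp> v \<and> \<not> w \<perp> v"
    obtain a where a: "u1 \<perp> w - a *s x"
      using orth_codim u1(2) orth_sym by blast
    obtain b where b: "u2 \<perp> w - b *s y"
      using orth_codim u2(2) orth_sym by blast
    \<comment> \<open>This is \<open>w\<close> corrected to be orthogonal to \<open>u1\<close> and
      \<open>u2\<close>. Every \<open>v\<close> is a combination of these two plus a vector
      orthogonal to \<open>x\<close> and \<open>y\<close>, hence to \<open>w\<close> by the
      assumption \<open>*\<close>. So \<open>w'\<close> is orthogonal to everything.\<close>
    define w' where "w' = w - a *s x - b *s y"
    have "u1 \<perp> w'"
      unfolding w'_def by (rule orth_diff[OF a orth_scale[OF orth_sym[OF u1(1)]]])
    moreover have "u2 \<perp> w'"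
    proof -
      have "u2 \<perp> (w - b *s y) - a *s x"
        by (rule orth_diff[OF b orth_scale[OF orth_sym[OF u2(1)]]])
      then show ?thesis
        by (simp add: w'_def algebra_simps)
    qed
    ultimately have w'u: "w' \<perp> u1" "w' \<perp> u2"
      using orth_sym by blast+
    have "w' \<perp> v" for v
    proof -
      obtain k where k: "x \<perp> v - k *s u1"
        using orth_codim[OF u1(2)] by blast
      obtain m where m: "y \<perp> (v - k *s u1) - m *s u2"
        using orth_codim[OF u2(2)] by blast
      let ?v = "(v - k *s u1) - m *s u2"
      have x: "x \<perp> ?v"
        by (rule orth_diff[OF k orth_scale[OF u2(1)]])
      then have w: "w \<perp> ?v"
        using * m by blast
      have "?v \<perp> w'"
        unfolding w'_def
        by (rule orth_diff[OF orth_diff[OF orth_sym[OF w] orth_scale[OF orth_sym[OF x]]]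
              orth_scale[OF orth_sym[OF m]]])
      then have "w' \<perp> ((v - k *s u1) - m *s u2) + (m *s u2 + k *s u1)"
        using orth_add[OF orth_sym orth_add[OF orth_scale[OF w'u(2)] orth_scale[OF w'u(1)]]] by blast
      then show ?thesis
        by simp
    qed
    moreover have "w' \<in> Sg"
    proof -
      have "vec.span {x, y, w} \<in> \<P>"
        using Sg orth orth_sym Sg_self by (intro span_mem) auto
      moreover have "w' \<in> vec.span {x, y, w}"
        unfolding w'_def by (intro vec.span_diff vec.span_scale) (auto intro: vec.span_base)
      ultimately show ?thesis
        using mem_Sg by blast
    qed
    ultimately have "w' = 0"
      using nondegenerate by blast
    then have "w = a *s x + b *s y"
      by (simp add: w'_def algebra_simps)
    moreover have "a *s x + b *s y \<in> vec.span {x, y}"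
      by (intro vec.span_add vec.span_scale) (auto intro: vec.span_base)
    ultimately show False
      using w by simp
  qed
  then obtain v where v: "x \<perp> v" "y \<perp> v" "\<not> w \<perp> v"
    by blast
  \<comment> \<open>The vector \<open>v\<close> may fail to be singular. Adding a multiple of
    \<open>w\<close>, which is orthogonal to \<open>x\<close>, \<open>y\<close> and itself, repairs
    this and keeps all three relations.\<close>
  then obtain c where c: "v + c *s w \<in> Sg"
    using Sg_reach[OF Sg(3)] by blast
  have "\<not> w \<perp> v + c *s w"
    using v(3) orth_diff[of w "v + c *s w" "c *s w"] orth_scale[of w w c] Sg_self[OF Sg(3)] by auto
  then show ?thesis
    using c v(1,2) orth(2,3) by (intro bexI[of _ "v + c *s w"] conjI orth_add orth_scale)
qed

text \<open>Otherwise adjoining \<open>v\<close> to \<open>G\<close> would give a strictly larger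
  member of \<open>\<P>\<close>.\<close>

lemma maximal_mem:
  assumes G: "G \<in> generators \<P>" and v: "v \<in> Sg" "\<And>g. g \<in> G \<Longrightarrow> g \<perp> v"
  shows "v \<in> G"
proof -
  have "G \<in> \<P>" and max: "\<And>H. H \<in> \<P> \<Longrightarrow> G \<subseteq> H \<Longrightarrow> H = G"
    using G by (auto simp: generators_def)
  have "vec.span (insert v G) \<in> \<P>"
    using v \<open>G \<in> \<P>\<close> Sg_self orth_sym by (intro span_mem) (auto intro: mem_Sg mem_orth)
  moreover have "G \<subseteq> vec.span (insert v G)"
    by (auto intro: vec.span_base)
  ultimately show ?thesis
    using max[of "vec.span (insert v G)"] vec.span_base[of v "insert v G"] by blast
qed

end

lemma dim2_basis:
  fixes S :: "('a::field ^ 'n::finite) set"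
  assumes "vec.subspace S" "vec.dim S = 2" "a \<in> S" "a \<noteq> 0"
  obtains b where "b \<in> S" "b \<notin> vec.span {a}" "S = vec.span {a, b}"
proof -
  have dim1: "vec.dim (vec.span {a}) = 1"
    using assms(4) vec.dim_span_eq_card_independent[of "{a}"] by simp
  have sub: "vec.span {a} \<subseteq> S"
    using assms by (simp add: vec.span_minimal)
  have "\<not> S \<subseteq> vec.span {a}"
    using dim1 assms(2) vec.dim_subset[of S "vec.span {a}"] by auto
  then obtain b where b: "b \<in> S" "b \<notin> vec.span {a}"
    by blast
  have "vec.dim (vec.span {a, b}) = 2"
    using vec.dim_insert[of b "{a}"] b(2) dim1 by (simp add: insert_commute vec.dim_span)
  then have "vec.span {a, b} = S"
    using assms b(1) by (intro vec.subspace_dim_equal) (auto simp: vec.subspace_span vec.span_minimal)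
  then show ?thesis
    using that b by blast
qed

text \<open>This parametrizes the points of a line by the field and one further point, which makes
  them countable as \<open>q + 1\<close>.\<close>

lemma (in polar_perp) points_in_span_pair:
  assumes "u \<in> Sg" "u \<noteq> 0" "v \<in> Sg" "v \<notin> vec.span {u}" "u \<perp> v"
  shows "points_in \<P> (vec.span {u, v}) = insert (vec.span {u}) (range (\<lambda>c. vec.span {v + c *s u}))"
    and "inj (\<lambda>c. vec.span {v + c *s u})" "vec.span {u} \<notin> range (\<lambda>c. vec.span {v + c *s u})"
proof -
  have nu: "v + c *s u \<notin> vec.span {u}" for c
    using assms(4) vec.span_diff[of "v + c *s u" "{u}" "c *s u"]
    by (auto simp: vec.span_base vec.span_scale)
  then have ne: "v + c *s u \<noteq> 0" for c
    using vec.span_zero by metis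
  have mem: "vec.span {u, v} \<in> \<P>"
    using assms Sg_self orth_sym by (intro span_mem) auto
  have in_span: "v + c *s u \<in> vec.span {u, v}" for c
    by (intro vec.span_add vec.span_scale) (auto intro: vec.span_base)
  have rescale: "vec.span {k *s w} = vec.span {w}" if "k \<noteq> 0" for k and w :: "'a ^ 'n"
  proof -
    have "(1 / k) *s (k *s w) \<in> vec.span {k *s w}"
      by (intro vec.span_scale vec.span_base) simp
    then have "w \<in> vec.span {k *s w}"
      using that by simp
    moreover have "k *s w \<in> vec.span {w}"
      by (intro vec.span_scale vec.span_base) simp
    ultimately show ?thesis
      by (simp add: vec.span_eq)
  qed
  show "points_in \<P> (vec.span {u, v}) = insert (vec.span {u}) (range (\<lambda>c. vec.span {v + c *s u}))"
    (is "?A = ?B")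
  proof
    show "?B \<subseteq> ?A"
      using assms in_span ne mem mem_Sg[OF mem in_span]
      by (auto simp: span_singleton_in_points_in vec.span_base)
    show "?A \<subseteq> ?B"
    proof
      fix p assume "p \<in> ?A"
      then obtain w where w: "w \<noteq> 0" "p = vec.span {w}" "w \<in> vec.span {u, v}"
        by (auto simp: points_in_def elim!: pointE intro: vec.span_base)
      obtain k where "w - k *s v \<in> vec.span {u}"
        using w(3) by (auto simp: insert_commute[of u v] vec.span_insert[of v "{u}"])
      then obtain m where "w - k *s v = m *s u"
        by (auto simp: vec.span_singleton)
      then have m: "w = k *s v + m *s u"
        by (simp add: diff_eq_eq add.commute)
      show "p \<in> ?B"
      proof (cases "k = 0")
        case True
        then have "m \<noteq> 0"
          using m w(1) by auto
        then show ?thesis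
          using rescale[of m u] m True w(2) by simp
      next
        case False
        then have "w = k *s (v + (m / k) *s u)"
          by (simp add: m vec.scale_right_distrib)
        then have "p = vec.span {v + (m / k) *s u}"
          using rescale[OF False] w(2) by (simp only:)
        then show ?thesis
          by blast
      qed
    qed
  qed
  show "inj (\<lambda>c. vec.span {v + c *s u})"
  proof (rule injI)
    fix c c' assume "vec.span {v + c *s u} = vec.span {v + c' *s u}"
    then have "v + c *s u \<in> vec.span {v + c' *s u}"
      by (metis insertI1 vec.span_base)
    then obtain k where k: "v + c *s u = k *s (v + c' *s u)"
      by (auto simp: vec.span_singleton)
    have "(1 - k) *s v = (v + c *s u) - k *s v - c *s u"
      by (simp add: vec.scale_left_diff_distrib)
    also have "\<dots> = (k * c' - c) *s u"
      unfolding k by (simp add: vec.scale_left_diff_distrib vec.scale_right_distrib)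
    finally have eq: "(1 - k) *s v = (k * c' - c) *s u" .
    \<comment> \<open>Comparison of coefficients in \<open>eq\<close>: for
      \<open>k \<noteq> 1\<close> the vector \<open>v\<close> would be a multiple of
      \<open>u\<close>.\<close>
    have "k = 1"
    proof (rule ccontr)
      assume "k \<noteq> 1"
      then have "inverse (1 - k) * (1 - k) = 1"
        by simp
      then have "v = inverse (1 - k) *s ((1 - k) *s v)"
        by (simp only: vec.scale_scale vec.scale_one)
      also have "\<dots> \<in> vec.span {u}"
        unfolding eq by (intro vec.span_scale vec.span_base) simp
      finally show False
        using assms(4) by simp
    qed
    with eq have "(c' - c) *s u = 0"
      by simp
    then show "c = c'"
      using assms(2) by simp
  qed
  show "vec.span {u} \<notin> range (\<lambda>c. vec.span {v + c *s u})"
  proof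
    assume "vec.span {u} \<in> range (\<lambda>c. vec.span {v + c *s u})"
    then obtain c where "vec.span {u} = vec.span {v + c *s u}"
      by blast
    then have "v + c *s u \<in> vec.span {u}"
      using vec.span_base[of "v + c *s u" "{v + c *s u}"] by simp
    then show False
      using nu by blast
  qed
qed

section \<open>Graphs with thick lines\<close>

text \<open>The reflexive version of adjacency matches orthogonality, under which every singular
  point is orthogonal to itself.\<close>

definition closed_adj :: "'v pair_pre_digraph \<Rightarrow> 'v \<Rightarrow> 'v \<Rightarrow> bool" where
  "closed_adj G x y \<longleftrightarrow> x = y \<or> (x, y) \<in> parcs G"

text \<open>An isomorphism-invariant trace of the lines of a polar space: with
  \<open>n = q + 1\<close>, \<open>K\<close> can be taken as the line through \<open>x\<close> and
  \<open>y\<close>.\<close>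

definition on_thick_lines :: "nat \<Rightarrow> 'v pair_pre_digraph \<Rightarrow> bool" where
  "on_thick_lines n G \<longleftrightarrow> (\<forall>x y. (x, y) \<in> parcs G \<longrightarrow>
     (\<exists>K\<subseteq>pverts G. card K = n \<and>
       (\<forall>v\<in>pverts G. closed_adj G x v \<and> closed_adj G y v \<longrightarrow> (\<forall>k\<in>K. closed_adj G k v))))"

text \<open>The set \<open>K\<close> is carried over by the vertex map. Tail and head are the
  projections in both graphs, so the arc map is induced by the vertex map.\<close>

lemma on_thick_lines_iso:
  assumes iso: "digraph_iso (with_proj G) (with_proj H)" and G: "on_thick_lines n G"
  shows "on_thick_lines n H"
proof -
  obtain f where f: "pre_digraph.digraph_isomorphism (with_proj G) f"
    and H: "with_proj H = app_iso f (with_proj G)"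
    using iso by (auto simp: digraph_iso_def)
  define \<phi> where "\<phi> = iso_verts f"
  have wf: "wf_digraph (with_proj G)" and inj: "inj_on \<phi> (pverts G)"
    and ends: "\<And>a. a \<in> parcs G \<Longrightarrow> \<phi> (fst a) = iso_tail f (iso_arcs f a)"
      "\<And>a. a \<in> parcs G \<Longrightarrow> \<phi> (snd a) = iso_head f (iso_arcs f a)"
    using f by (auto simp: pre_digraph.digraph_isomorphism_def \<phi>_def)
  have verts: "pverts H = \<phi> ` pverts G"
    using arg_cong[OF H, of verts] by (simp add: \<phi>_def)
  have tail_head: "iso_tail f = fst" "iso_head f = snd"
    using arg_cong[OF H, of tail] arg_cong[OF H, of head] by simp_all
  have "iso_arcs f a = (\<phi> (fst a), \<phi> (snd a))" if "a \<in> parcs G" for a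
    using ends[OF that] by (simp add: tail_head prod_eq_iff)
  then have arcs: "parcs H = (\<lambda>a. (\<phi> (fst a), \<phi> (snd a))) ` parcs G"
    using arg_cong[OF H, of arcs] by simp
  have arc_verts: "x \<in> pverts G" "y \<in> pverts G" if "(x, y) \<in> parcs G" for x y
    using wf_digraph.tail_in_verts[OF wf, of "(x, y)"] wf_digraph.head_in_verts[OF wf, of "(x, y)"] that
    by simp_all
  have adj: "closed_adj H (\<phi> x) (\<phi> y) \<longleftrightarrow> closed_adj G x y" if "x \<in> pverts G" "y \<in> pverts G" for x y
    using that inj arc_verts by (fastforce simp: closed_adj_def arcs inj_on_eq_iff image_iff)
  show ?thesis
    unfolding on_thick_lines_def
  proof (intro allI impI)
    fix x' y' assume "(x', y') \<in> parcs H"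
    then obtain x y where xy: "(x, y) \<in> parcs G" "x' = \<phi> x" "y' = \<phi> y"
      by (auto simp: arcs)
    obtain K where K: "K \<subseteq> pverts G" "card K = n"
      "\<And>v k. v \<in> pverts G \<Longrightarrow> closed_adj G x v \<Longrightarrow> closed_adj G y v \<Longrightarrow> k \<in> K \<Longrightarrow> closed_adj G k v"
      using G xy(1) unfolding on_thick_lines_def by meson
    have "card (\<phi> ` K) = n"
      using K(1,2) inj by (metis card_image inj_on_subset)
    moreover have "closed_adj H k' v'"
      if "v' \<in> pverts H" "closed_adj H x' v'" "closed_adj H y' v'" "k' \<in> \<phi> ` K" for v' k'
      using that K(1) K(3) arc_verts[OF xy(1)] by (auto simp: verts xy(2,3) adj subset_iff)
    ultimately show "\<exists>K\<subseteq>pverts H. card K = n \<and>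
        (\<forall>v\<in>pverts H. closed_adj H x' v \<and> closed_adj H y' v \<longrightarrow> (\<forall>k\<in>K. closed_adj H k v))"
      using K(1) by (intro exI[of _ "\<phi> ` K"]) (auto simp: verts)
  qed
qed

locale finite_polar_perp = polar_perp \<P> Sg orth
  for \<P> :: "('a::{field,finite} ^ 'n::finite) set set" and Sg and orth (infix "\<perp>" 50)
begin

lemma card_points_in_line:
  assumes "u \<in> Sg" "u \<noteq> 0" "v \<in> Sg" "v \<notin> vec.span {u}" "u \<perp> v"
  shows "card (points_in \<P> (vec.span {u, v})) = CARD('a) + 1"
  using points_in_span_pair[OF assms] card_image[of "\<lambda>c. vec.span {v + c *s u}" UNIV] by simp

lemma span_singleton_eqI:
  assumes "v \<in> vec.span {u}" "v \<noteq> 0"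
  shows "vec.span {u} = vec.span {v}"
proof -
  obtain k where k: "v = k *s u"
    using assms(1) by (auto simp: vec.span_singleton)
  then have "u = (1 / k) *s v"
    using assms(2) by auto
  then have "u \<in> vec.span {v}"
    by (metis insertI1 vec.span_base vec.span_scale)
  then show ?thesis
    using assms(1) by (simp add: vec.span_eq)
qed

text \<open>For \<open>K\<close> serves the line spanned by \<open>u\<close> and \<open>v\<close>: a
  vector orthogonal to both is orthogonal to their span.\<close>

lemma collinearity_graph_on_thick_lines: "on_thick_lines (CARD('a) + 1) (collinearity_graph \<P>)"
  unfolding on_thick_lines_def
proof (intro allI impI)
  fix x y assume "(x, y) \<in> parcs (collinearity_graph \<P>)"
  then have xy: "x \<in> points \<P>" "y \<in> points \<P>" "x \<noteq> y" "x \<in> perp \<P> y"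
    by (auto simp: collinearity_graph_def)
  obtain u where u: "u \<noteq> 0" "u \<in> Sg" "x = vec.span {u}"
    using pointE[OF xy(1)] .
  obtain v where v: "v \<noteq> 0" "v \<in> Sg" "y = vec.span {v}"
    using pointE[OF xy(2)] .
  have uv: "u \<perp> v"
    using xy(4) u v orth_commute by (simp add: span_singletons_perp_iff)
  have "v \<notin> vec.span {u}"
    using span_singleton_eqI[of v u] u v xy(3) by blast
  note card = card_points_in_line[OF u(2,1) v(2) this uv]
  let ?G = "collinearity_graph \<P>"
  have adj: "closed_adj ?G (vec.span {s}) (vec.span {t}) \<longleftrightarrow> s \<perp> t"
    if "s \<in> Sg" "s \<noteq> 0" "t \<in> Sg" "t \<noteq> 0" for s t
  proof -
    have "s \<perp> t" if "vec.span {s} = vec.span {t}"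
    proof -
      have "vec.span {s} \<in> \<P>"
        using \<open>s \<in> Sg\<close> Sg_self by (intro span_mem) auto
      moreover have "s \<in> vec.span {s}" "t \<in> vec.span {s}"
        using that by (auto intro: vec.span_base)
      ultimately show ?thesis
        using mem_orth by blast
    qed
    then show ?thesis
      using that orth_commute
      by (auto simp: closed_adj_def collinearity_graph_def point_span span_singletons_perp_iff)
  qed
  have "closed_adj ?G k w"
    if w: "w \<in> points \<P>" "closed_adj ?G x w" "closed_adj ?G y w"
      and k: "k \<in> points_in \<P> (vec.span {u, v})" for w k
  proof -
    obtain t where t: "t \<noteq> 0" "t \<in> Sg" "w = vec.span {t}"
      using pointE[OF w(1)] .
    have "k \<in> points \<P>" "k \<subseteq> vec.span {u, v}"
      using k by (auto simp: points_in_def)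
    then obtain s where s: "s \<noteq> 0" "s \<in> Sg" "k = vec.span {s}" "s \<in> vec.span {u, v}"
      by (auto elim!: pointE intro: vec.span_base)
    have "t \<perp> u" "t \<perp> v"
      using w u v t orth_commute by (auto simp: adj)
    then have "t \<perp> s"
      using orth_span[of "{u, v}" t s] s(4) by auto
    then show ?thesis
      using s t orth_commute by (simp add: adj)
  qed
  then show "\<exists>K\<subseteq>pverts ?G. card K = CARD('a) + 1 \<and>
      (\<forall>w\<in>pverts ?G. closed_adj ?G x w \<and> closed_adj ?G y w \<longrightarrow> (\<forall>k\<in>K. closed_adj ?G k w))"
    using card by (intro exI[of _ "points_in \<P> (vec.span {u, v})"])
      (auto simp: collinearity_graph_def points_in_def)
qed

end

section \<open>The switched graph\<close>

text \<open>A subspace not inside \<open>L\<close> is determined by its vectors outside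
  \<open>L\<close>: if \<open>v\<close> is one of them, each \<open>w\<close> in \<open>L\<close> is
  the difference of \<open>w + v\<close> and \<open>v\<close>, both outside
  \<open>L\<close>.\<close>

lemma (in polar_perp) affine_part_eqD:
  assumes L: "L \<in> \<P>" and U: "U \<in> \<P>" and W: "W \<in> \<P>"
    and eq: "affine_part \<P> L U = affine_part \<P> L W" and u: "u \<in> U" "u \<notin> L"
  shows "U = W"
proof -
  have mono: "V \<subseteq> V'"
    if V: "V \<in> \<P>" "V' \<in> \<P>" "affine_part \<P> L V = affine_part \<P> L V'" and v: "v \<in> V" "v \<notin> L" for V V' v
  proof
    have off: "w \<in> V'" if "w \<in> V" "w \<notin> L" for w
      using span_singleton_in_affine_part[OF L V(1)] span_singleton_in_affine_part[OF L V(2)]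
        mem_Sg[OF V(1)] V(3) that by blast
    fix w assume w: "w \<in> V"
    show "w \<in> V'"
    proof (cases "w \<in> L")
      case True
      then have "w + v \<notin> L"
        using v(2) vec.subspace_diff[OF mem_subspace[OF L], of "w + v" w] by auto
      moreover have "w + v \<in> V"
        using w v(1) mem_subspace[OF V(1)] by (simp add: vec.subspace_add)
      ultimately have "(w + v) - v \<in> V'"
        using off v mem_subspace[OF V(2)] vec.subspace_diff by blast
      then show ?thesis
        by simp
    qed (use off w in blast)
  qed
  have "U \<subseteq> W"
    using mono[OF U W eq u] .
  then show ?thesis
    using mono[OF W U eq[symmetric], of u] u by blast
qed

text \<open>Handles the equality case of \<open>closed_adj\<close>.\<close>

lemma (in polar_perp) span_singleton_eq_orth:
  assumes "s \<in> Sg" "vec.span {s} = vec.span {t}"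
  shows "s \<perp> t"
proof -
  have "t \<in> vec.span {s}"
    using assms(2) by (simp add: vec.span_base)
  then show ?thesis
    using orth_span[of "{s}" s t] Sg_self[OF assms(1)] by blast
qed

context finite_polar_perp
begin

lemma switched_graph_not_on_thick_lines:
  fixes L \<pi> l z H\<^sub>z H\<^sub>z' :: "('a ^ 'n) set" and N :: nat and P :: "nat \<Rightarrow> ('a ^ 'n) set"
  assumes L: "L \<in> \<P>"
    and P: "bij_betw P {1..N} {G \<in> generators \<P>. L \<subseteq> G}" and N: "N \<ge> 1"
    and \<pi>: "\<pi> \<in> \<P>" "\<pi> \<subseteq> P 1" "\<not> \<pi> \<subseteq> L"
    and l: "l \<in> \<P>" "vec.dim l = 2" "points_in \<P> l \<subseteq> perp \<P> \<pi>" "l \<inter> P 1 = {0}"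
    and z: "z \<in> points_in \<P> l"
    and H\<^sub>z: "H\<^sub>z \<in> \<P>" "points_in \<P> H\<^sub>z = perp \<P> z \<inter> points_in \<P> (P 1)"
    and H\<^sub>z': "H\<^sub>z' \<in> \<P>" "vec.dim H\<^sub>z' = vec.dim L" "H\<^sub>z' \<noteq> H\<^sub>z" "H\<^sub>z' \<subseteq> P 1"
    and parallel: "parallel \<P> L (P 1) (affine_part \<P> L H\<^sub>z) (affine_part \<P> L H\<^sub>z')"
    and \<sigma>\<^sub>1: "\<sigma>\<^sub>1 = Transposition.transpose (affine_part \<P> L H\<^sub>z) (affine_part \<P> L H\<^sub>z')"
  shows "\<not> on_thick_lines (CARD('a) + 1) (switched_graph \<P> L N P ((\<lambda>i. id)(1 := \<sigma>\<^sub>1)))"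
proof

  \<comment> \<open>Notation and the generators through \<open>L\<close>\<close>
  define G where "G = P 1"
  define A where "A = affine_part \<P> L G"
  define A\<^sub>z where "A\<^sub>z = affine_part \<P> L H\<^sub>z"
  define A\<^sub>z' where "A\<^sub>z' = affine_part \<P> L H\<^sub>z'"
  define \<sigma> where "\<sigma> = (\<lambda>i :: nat. id)(1 := \<sigma>\<^sub>1)"
  define \<Gamma> where "\<Gamma> = switched_graph \<P> L N P \<sigma>"
  define adj where "adj = switched_adj \<P> L N P \<sigma>"
  have P_gen: "P i \<in> generators \<P>" "L \<subseteq> P i" if "i \<in> {1..N}" for i
    using bij_betwE[OF P] that by auto
  then have P_mem: "P i \<in> \<P>" if "i \<in> {1..N}" for i
    using that by (auto simp: generators_def)
  have G: "G \<in> generators \<P>" "L \<subseteq> G" "G \<in> \<P>"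
    using P_gen[of 1] P_mem[of 1] N by (auto simp: G_def)
  note sub = mem_subspace[OF L] mem_subspace[OF G(3)] mem_subspace[OF l(1)]
    mem_subspace[OF H\<^sub>z(1)] mem_subspace[OF H\<^sub>z'(1)]
  have lG: "t = 0" if "t \<in> l" "t \<in> G" for t
    using l(4) that by (auto simp: G_def)

  \<comment> \<open>Vectors spanning \<open>z\<close> and \<open>l\<close>, and a vector of \<pi>
    outside \<open>L\<close>\<close>
  obtain a where a: "a \<noteq> 0" "a \<in> Sg" "z = vec.span {a}"
    using z by (auto simp: points_in_def elim: pointE)
  then have "a \<in> l"
    using z l(1) span_singleton_in_points_in by blast
  obtain b where b: "b \<in> l" "b \<notin> vec.span {a}" and l_span: "l = vec.span {a, b}"
    using dim2_basis[OF sub(3) l(2) \<open>a \<in> l\<close> a(1)] .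
  have l_Sg: "t \<in> Sg" and l_orth: "s \<perp> t" if "s \<in> l" "t \<in> l" for s t
    using that mem_Sg[OF l(1)] mem_orth[OF l(1)] by blast+
  \<comment> \<open>The vector \<open>p\<close> is the main witness: it is orthogonal to all of
    \<open>l\<close> and lies in \<open>H\<^sub>z\<close> but not in \<open>L\<close>, so the
    switching separates its point from \<open>z\<close>.\<close>
  obtain p where p: "p \<in> \<pi>" "p \<notin> L"
    using \<pi>(3) by blast
  have pG: "p \<in> G" and p_Sg: "p \<in> Sg"
    using p(1) \<pi>(2) mem_Sg[OF G(3)] by (auto simp: G_def)
  have p0: "p \<noteq> 0"
    using p(2) vec.subspace_0[OF sub(1)] by blast
  have lp: "t \<perp> p" if "t \<in> l" for t
  proof (cases "t = 0")
    case True
    then show ?thesis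
      using orth_zero orth_sym by blast
  next
    case False
    then have "vec.span {t} \<in> perp \<P> \<pi>"
      using that l(1,3) l_Sg[OF that that] span_singleton_in_points_in by blast
    then show ?thesis
      using span_singleton_perp_iff[OF \<pi>(1) l_Sg[OF that that] False] p(1) orth_sym by blast
  qed

  \<comment> \<open>The two parallel hyperplanes\<close>
  have Hz_iff: "v \<in> H\<^sub>z \<longleftrightarrow> v \<in> G \<and> a \<perp> v" for v
  proof (cases "v = 0")
    case True
    then show ?thesis
      using vec.subspace_0[OF sub(4)] vec.subspace_0[OF sub(2)] orth_zero by simp
  next
    case False
    have "v \<in> H\<^sub>z \<longleftrightarrow> v \<in> G \<and> a \<perp> v" if "v \<in> Sg"
    proof -
      have "v \<in> H\<^sub>z \<longleftrightarrow> vec.span {v} \<in> points_in \<P> H\<^sub>z"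
        using span_singleton_in_points_in[OF H\<^sub>z(1) that False] by simp
      also have "\<dots> \<longleftrightarrow> vec.span {v} \<in> perp \<P> z \<and> vec.span {v} \<in> points_in \<P> G"
        by (simp add: H\<^sub>z(2) G_def)
      also have "\<dots> \<longleftrightarrow> v \<in> G \<and> a \<perp> v"
        using span_singleton_in_points_in[OF G(3) that False]
          span_singletons_perp_iff[OF a(2,1) that False] a(3) by blast
      finally show ?thesis .
    qed
    then show ?thesis
      using mem_Sg[OF H\<^sub>z(1)] mem_Sg[OF G(3)] by blast
  qed
  have pH: "p \<in> H\<^sub>z"
    using Hz_iff pG lp[OF \<open>a \<in> l\<close>] by blast
  have Az: "A\<^sub>z = perp \<P> z \<inter> A"
    using H\<^sub>z(2) by (auto simp: A\<^sub>z_def A_def affine_part_def G_def)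

  \<comment> \<open>\<open>parallel\<close> speaks of some hyperplanes with the given affine parts;
    \<open>affine_part_eqD\<close> identifies them with \<open>H\<^sub>z\<close> and
    \<open>H\<^sub>z'\<close>.\<close>
  obtain H H' where H: "H \<in> \<P>" "H \<noteq> L" "A\<^sub>z = affine_part \<P> L H"
    and H': "H' \<in> \<P>" "H' \<noteq> L" "A\<^sub>z' = affine_part \<P> L H'" "vec.dim H' + 1 = vec.dim G"
    and HH': "H \<inter> L = H' \<inter> L"
    using parallel unfolding parallel_def A\<^sub>z_def A\<^sub>z'_def G_def by blast
  have "H\<^sub>z = H"
    using affine_part_eqD[OF L H\<^sub>z(1) H(1) _ pH p(2)] H(3) by (simp add: A\<^sub>z_def)
  have "vec.dim L < vec.dim G"
    using vec.subspace_dim_equal[OF sub(1,2) G(2)] pG p(2) by force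
  \<comment> \<open>The dimension of \<open>H'\<close> is at least that of \<open>L\<close>, so
    inclusion would mean equality.\<close>
  then have "\<not> H' \<subseteq> L"
    using vec.subspace_dim_equal[OF mem_subspace[OF H'(1)] sub(1)] H'(2,4) by auto
  then obtain h where "h \<in> H'" "h \<notin> L"
    by blast
  then have "H\<^sub>z' = H'"
    using affine_part_eqD[OF L H'(1) H\<^sub>z'(1)] H'(3) by (auto simp: A\<^sub>z'_def)
  \<comment> \<open>As a hyperplane of \<open>G\<close> with the dimension of \<open>L\<close>,
    \<open>H\<^sub>z'\<close> shows that \<open>L\<close> is a hyperplane of \<open>G\<close> as
    well.\<close>
  then have dim: "vec.dim L + 1 = vec.dim G"
    using H'(4) H\<^sub>z'(2) by simp
  have HL: "H\<^sub>z \<inter> L = H\<^sub>z' \<inter> L"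
    using HH' \<open>H\<^sub>z = H\<close> \<open>H\<^sub>z' = H'\<close> by simp

  have codim: "\<exists>c. v - c *s h \<in> L" if "v \<in> G" "h \<in> G" "h \<notin> L" for v h
  proof -
    have span_L: "vec.span L = L"
      using sub(1) by (simp add: vec.span_eq_iff)
    have "h \<notin> vec.span L"
      unfolding span_L by (rule that(3))
    then have "vec.dim (vec.span (insert h L)) = vec.dim G"
      using dim by (simp add: vec.dim_insert)
    moreover have "vec.span (insert h L) \<subseteq> G"
      using that(2) G(2) sub(2) by (intro vec.span_minimal) auto
    ultimately have "vec.span (insert h L) = G"
      using vec.subspace_dim_equal[OF vec.subspace_span sub(2)] by simp
    then show ?thesis
      using that(1) span_L by (auto simp: vec.span_insert)
  qed
  \<comment> \<open>Each of the two hyperplanes is spanned by \<open>h\<close> and its intersection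
    with \<open>L\<close>. These intersections agree, so a common \<open>h\<close> outside
    \<open>L\<close> would make the hyperplanes equal.\<close>
  have disj: "h \<in> L" if "h \<in> H\<^sub>z" "h \<in> H\<^sub>z'" for h
  proof (rule ccontr)
    assume "h \<notin> L"
    have incl: "U \<subseteq> W"
      if U: "vec.subspace U" "U \<subseteq> G" "h \<in> U" and W: "vec.subspace W" "h \<in> W" and UW: "U \<inter> L \<subseteq> W" for U W
    proof
      fix u assume u: "u \<in> U"
      then obtain c where "u - c *s h \<in> L"
        using codim U(2,3) \<open>h \<notin> L\<close> by blast
      moreover have "u - c *s h \<in> U"
        using U(1,3) u by (simp add: vec.subspace_diff vec.subspace_scale)
      ultimately have "(u - c *s h) + c *s h \<in> W"
        using UW W by (blast intro: vec.subspace_add vec.subspace_scale)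
      then show "u \<in> W"
        by simp
    qed
    have "H\<^sub>z' \<subseteq> G"
      using H\<^sub>z'(4) by (simp add: G_def)
    then have "H\<^sub>z = H\<^sub>z'"
      using incl[of H\<^sub>z H\<^sub>z'] incl[of H\<^sub>z' H\<^sub>z] sub HL that Hz_iff by blast
    then show False
      using H\<^sub>z'(3) by simp
  qed
  have disjoint: "A\<^sub>z \<inter> A\<^sub>z' = {}"
  proof -
    have False if "x \<in> A\<^sub>z" "x \<in> A\<^sub>z'" for x
    proof -
      have "x \<in> points \<P>"
        using that(1) by (auto simp: A\<^sub>z_def affine_part_def points_in_def)
      then obtain v where "v \<in> Sg" "x = vec.span {v}"
        by (auto elim: pointE)
      then show False
        using that disj span_singleton_in_affine_part[OF L] H\<^sub>z(1) H\<^sub>z'(1)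
        by (auto simp: A\<^sub>z_def A\<^sub>z'_def)
    qed
    then show ?thesis
      by blast
  qed
  have span_A: "vec.span {v} \<in> A \<longleftrightarrow> v \<in> G \<and> v \<notin> L" if "v \<in> Sg" for v
    using span_singleton_in_affine_part[OF L G(3) that] by (simp add: A_def)
  have p_Az: "vec.span {p} \<in> A\<^sub>z"
    using span_singleton_in_affine_part[OF L H\<^sub>z(1) p_Sg] pH p(2) by (simp add: A\<^sub>z_def)
  then have p_A: "vec.span {p} \<in> A" and p_Az': "vec.span {p} \<notin> A\<^sub>z'"
    using disjoint Az by auto

  \<comment> \<open>Hyperplanes cut out by the points of \<open>l\<close> other than
    \<open>z\<close>\<close>
  obtain g where g: "g \<in> G" "\<not> g \<perp> a"
    using maximal_mem[OF G(1) a(2)] lG[OF \<open>a \<in> l\<close>] a(1) by blast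
  \<comment> \<open>The vector \<open>g\<close> exists because otherwise maximality of
    \<open>G\<close> would put \<open>a\<close> into \<open>G\<close>. The hyperplane of
    \<open>t\<close> contains \<open>p\<close>, which rules out \<open>A\<^sub>z'\<close>; ruling
    out \<open>A\<^sub>z\<close> takes \<open>g\<close>.\<close>
  have unswitched: "perp \<P> (vec.span {t}) \<inter> A \<noteq> A\<^sub>z" "perp \<P> (vec.span {t}) \<inter> A \<noteq> A\<^sub>z'"
    if t: "t \<in> l" "t \<notin> vec.span {a}" for t
  proof -
    have t0: "t \<noteq> 0"
      using t(2) vec.span_zero by metis
    have t_Sg: "t \<in> Sg"
      using l_Sg t(1) by blast
    have tp: "t \<perp> p"
      using lp t(1) .
    show "perp \<P> (vec.span {t}) \<inter> A \<noteq> A\<^sub>z'"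
      using span_singletons_perp_iff[OF t_Sg t0 p_Sg p0] tp p_A p_Az' by blast
    show "perp \<P> (vec.span {t}) \<inter> A \<noteq> A\<^sub>z"
    proof
      assume eq: "perp \<P> (vec.span {t}) \<inter> A = A\<^sub>z"
      have off: "t \<perp> h" if h: "h \<in> H\<^sub>z" "h \<notin> L" for h
      proof -
        have "h \<in> Sg" "h \<noteq> 0"
          using h mem_Sg[OF H\<^sub>z(1)] vec.subspace_0[OF sub(1)] by auto
        moreover from this have "vec.span {h} \<in> A\<^sub>z"
          using h span_singleton_in_affine_part[OF L H\<^sub>z(1)] by (simp add: A\<^sub>z_def)
        ultimately show ?thesis
          using eq span_singletons_perp_iff[OF t_Sg t0, of h] by blast
      qed
      \<comment> \<open>The equation of affine parts only reaches vectors outside \<open>L\<close>;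
        those in \<open>L\<close> are written as \<open>(h + p) - p\<close>.\<close>
      have tH: "t \<perp> h" if h: "h \<in> H\<^sub>z" for h
      proof (cases "h \<in> L")
        case True
        then have "h + p \<notin> L"
          using p(2) vec.subspace_diff[OF sub(1), of "h + p" h] by auto
        moreover have "h + p \<in> H\<^sub>z"
          using h pH sub(4) by (simp add: vec.subspace_add)
        ultimately have "t \<perp> (h + p) - p"
          using off tp orth_diff by blast
        then show ?thesis
          by simp
      qed (use off h in blast)
      \<comment> \<open>The vector \<open>t - c *s a\<close> of \<open>l\<close> is orthogonal to
        \<open>g\<close> and to \<open>H\<^sub>z\<close>, which together span \<open>G\<close>. By
        maximality it lies in \<open>G\<close>, and \<open>l\<close> meets \<open>G\<close> only in
        0.\<close>
      obtain c where c: "g \<perp> t - c *s a"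
        using orth_codim[OF g(2)] by blast
      have "h \<perp> t - c *s a" if h: "h \<in> G" for h
      proof -
        have "\<not> a \<perp> g"
          using g(2) orth_sym by blast
        then obtain k where k: "a \<perp> h - k *s g"
          using orth_codim by blast
        have "h - k *s g \<in> G"
          using h g(1) sub(2) by (simp add: vec.subspace_diff vec.subspace_scale)
        then have "t \<perp> h - k *s g"
          using tH Hz_iff k by blast
        then have "h - k *s g \<perp> t - c *s a"
          by (rule orth_diff[OF orth_sym orth_scale[OF orth_sym[OF k]]])
        from orth_add[OF orth_sym[OF this] orth_scale[OF orth_sym[OF c]]]
        have "t - c *s a \<perp> (h - k *s g) + k *s g" .
        then show ?thesis
          using orth_sym by simp
      qed
      moreover have "t - c *s a \<in> l"
        using t(1) \<open>a \<in> l\<close> sub(3) by (simp add: vec.subspace_diff vec.subspace_scale)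
      ultimately have "t - c *s a = 0"
        using maximal_mem[OF G(1)] l_Sg lG by blast
      then have "t = c *s a"
        by simp
      then show False
        using t(2) by (simp add: vec.span_base vec.span_scale)
    qed
  qed

  \<comment> \<open>Position of \<open>z\<close> and of the affine parts\<close>
  have z_far: "z \<in> far_points \<P> L"
  proof -
    have "z \<notin> perp \<P> L"
    proof
      assume "z \<in> perp \<P> L"
      then have La: "s \<perp> a" if "s \<in> L" for s
        using that span_singleton_perp_iff[OF L a(2,1)] a(3) by blast
      \<comment> \<open>\<open>G\<close> is spanned by \<open>L\<close> and \<open>p\<close>. So if
        \<open>a\<close> were orthogonal to \<open>L\<close>, it would be orthogonal to
        \<open>g\<close>.\<close>
      obtain c where c: "g - c *s p \<in> L"
        using codim[OF g(1) pG p(2)] by blast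
      from orth_add[OF orth_sym[OF La[OF c]] orth_scale[OF lp[OF \<open>a \<in> l\<close>]]]
      have "a \<perp> (g - c *s p) + c *s p" .
      then show False
        using g(2) orth_sym by simp
    qed
    then show ?thesis
      using z by (simp add: far_points_def points_in_def)
  qed
  have not_far: "x \<notin> far_points \<P> L" if "i \<in> {1..N}" "x \<in> affine_part \<P> L (P i)" for i x
    using affine_part_not_far[OF that(2) _ P_gen(2)[OF that(1)] P_mem[OF that(1)]]
      mem_subspace[OF P_mem[OF that(1)]] P_mem[OF that(1)]
    by (auto simp: mem_iff)
  have A_P1: "A = affine_part \<P> L (P 1)"
    by (simp add: A_def G_def)
  \<comment> \<open>A point outside \<open>L\<close> spans \<open>G\<close> together with
    \<open>L\<close>, so a generator \<open>P i\<close> containing both equals \<open>G\<close>, and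
    injectivity of \<open>P\<close> gives the index.\<close>
  have index1: "i = 1" if i: "i \<in> {1..N}" "x \<in> affine_part \<P> L (P i)" and x: "x \<in> A" for i x
  proof -
    have "x \<in> points \<P>"
      using x by (auto simp: A_def affine_part_def points_in_def)
    then obtain v where v: "v \<in> Sg" "x = vec.span {v}"
      by (auto elim: pointE)
    then have vG: "v \<in> G" "v \<notin> L" and vP: "v \<in> P i"
      using x i span_A span_singleton_in_affine_part[OF L P_mem[OF i(1)]] by auto
    have "G \<subseteq> P i"
    proof
      fix u assume "u \<in> G"
      then obtain c where "u - c *s v \<in> L"
        using codim vG by blast
      then have "(u - c *s v) + c *s v \<in> P i"
        using P_gen(2)[OF i(1)] vP mem_subspace[OF P_mem[OF i(1)]]
        by (blast intro: vec.subspace_add vec.subspace_scale)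
      then show "u \<in> P i"
        by simp
    qed
    then have "P i = P 1"
      using G(1) P_mem[OF i(1)] by (auto simp: generators_def G_def)
    then show ?thesis
      using bij_betw_imp_inj_on[OF P] i(1) N by (auto simp: inj_on_eq_iff)
  qed

  \<comment> \<open>Adjacency in the switched graph\<close>
  define sees where "sees = (\<lambda>u v. \<exists>i\<in>{1..N}. u \<in> affine_part \<P> L (P i) \<and> v \<in> far_points \<P> L)"
  define hits where "hits = (\<lambda>u v. \<exists>i\<in>{1..N}. u \<in> affine_part \<P> L (P i) \<and>
    u \<in> \<sigma> i (perp \<P> v \<inter> affine_part \<P> L (P i)))"
  \<comment> \<open>\<open>sees\<close> is the case test of \<open>switched_adj\<close>, and
    \<open>hits\<close> the incidence by which that case is decided.\<close>
  have adj_cases: "adj u v \<longleftrightarrow>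
      (if sees u v then hits u v else if sees v u then hits v u else u \<in> perp \<P> v)" for u v
    by (simp only: adj_def switched_adj_def sees_def hits_def)
  have hits_iff: "hits u v \<longleftrightarrow> (if u \<in> A then u \<in> \<sigma>\<^sub>1 (perp \<P> v \<inter> A) else u \<in> perp \<P> v)"
    if "sees u v" for u v
  proof (cases "u \<in> A")
    case True
    then show ?thesis
      using index1[OF _ _ True] N unfolding A_P1 \<sigma>_def hits_def by force
  next
    case False
    then have "i \<noteq> 1" if "u \<in> affine_part \<P> L (P i)" for i
      using that A_P1 by blast
    then show ?thesis
      using that False by (auto simp: \<sigma>_def sees_def hits_def)
  qed
  have adj_iff: "adj u v \<longleftrightarrow> u \<in> \<sigma>\<^sub>1 (perp \<P> v \<inter> A)" "adj v u \<longleftrightarrow> u \<in> \<sigma>\<^sub>1 (perp \<P> v \<inter> A)"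
    if "u \<in> A" "v \<in> far_points \<P> L" for u v
  proof -
    have "sees u v"
      using that N unfolding A_P1 sees_def by force
    moreover have "\<not> sees v u"
      using not_far that(2) unfolding sees_def by blast
    ultimately show "adj u v \<longleftrightarrow> u \<in> \<sigma>\<^sub>1 (perp \<P> v \<inter> A)" "adj v u \<longleftrightarrow> u \<in> \<sigma>\<^sub>1 (perp \<P> v \<inter> A)"
      using hits_iff[of u v] that(1) by (simp_all add: adj_cases)
  qed
  have \<sigma>\<^sub>1_simps: "\<sigma>\<^sub>1 A\<^sub>z = A\<^sub>z'" "\<sigma>\<^sub>1 A\<^sub>z' = A\<^sub>z" "X \<noteq> A\<^sub>z \<Longrightarrow> X \<noteq> A\<^sub>z' \<Longrightarrow> \<sigma>\<^sub>1 X = X" for X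
    by (simp_all add: \<sigma>\<^sub>1 A\<^sub>z_def A\<^sub>z'_def transpose_apply_other)
  \<comment> \<open>These are the only pairs whose adjacency the switching can alter:
    \<sigma>\<open>\<^sub>1\<close> fixes all other hyperplanes, and the remaining permutations are
    identities.\<close>
  define sw where "sw = (\<lambda>u v. u \<in> A \<and> v \<in> far_points \<P> L \<and> perp \<P> v \<inter> A \<in> {A\<^sub>z, A\<^sub>z'})"
  have adj_unswitched: "adj u v \<longleftrightarrow> u \<in> perp \<P> v"
    if "\<not> sw u v" "\<not> sw v u" "u \<in> points \<P>" "v \<in> points \<P>" for u v
  proof -
    have hits_unswitched: "hits u v \<longleftrightarrow> u \<in> perp \<P> v" if "\<not> sw u v" "sees u v" for u v
      using that hits_iff[OF that(2)] \<sigma>\<^sub>1_simps(3)[of "perp \<P> v \<inter> A"]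
      by (auto simp: sw_def sees_def)
    show ?thesis
      using hits_unswitched[OF that(1)] hits_unswitched[OF that(2)] perp_commute[OF that(3,4)]
      by (simp add: adj_cases)
  qed
  have closed_adj_iff: "closed_adj \<Gamma> u v \<longleftrightarrow> u = v \<or> adj u v" if "u \<in> points \<P>" "v \<in> points \<P>" for u v
    using that by (auto simp: closed_adj_def \<Gamma>_def switched_graph_def adj_def)
  have closed_adj_orth: "closed_adj \<Gamma> (vec.span {s}) (vec.span {t}) \<longleftrightarrow> s \<perp> t"
    if "\<not> sw (vec.span {s}) (vec.span {t})" "\<not> sw (vec.span {t}) (vec.span {s})"
      and st: "s \<in> Sg" "s \<noteq> 0" "t \<in> Sg" "t \<noteq> 0" for s t
    using adj_unswitched[OF that(1,2)] closed_adj_iff point_span st span_singletons_perp_iff[OF st(3,4,1,2)]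
      span_singleton_eq_orth[OF st(1)] orth_commute by metis
  \<comment> \<open>A point of \<open>l\<close> other than \<open>z\<close> belongs to no switched
    pair: it is not in \<open>A\<close>, and its hyperplane is neither of the two swapped
    ones.\<close>
  have closed_adj_line: "closed_adj \<Gamma> (vec.span {t}) (vec.span {s}) \<longleftrightarrow> t \<perp> s"
    "closed_adj \<Gamma> (vec.span {s}) (vec.span {t}) \<longleftrightarrow> s \<perp> t"
    if t: "t \<in> l" "t \<notin> vec.span {a}" and s: "s \<in> Sg" "s \<noteq> 0" for s t
  proof -
    have "t \<noteq> 0"
      using t(2) vec.span_zero by metis
    moreover have "t \<in> Sg"
      using l_Sg t(1) by blast
    moreover have "\<not> sw (vec.span {s}) (vec.span {t})"
      using unswitched[OF t] by (simp add: sw_def)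
    moreover have "\<not> sw (vec.span {t}) (vec.span {s})"
      using span_A \<open>t \<in> Sg\<close> lG t(1) \<open>t \<noteq> 0\<close> by (auto simp: sw_def)
    ultimately show "closed_adj \<Gamma> (vec.span {t}) (vec.span {s}) \<longleftrightarrow> t \<perp> s"
      "closed_adj \<Gamma> (vec.span {s}) (vec.span {t}) \<longleftrightarrow> s \<perp> t"
      using closed_adj_orth s by blast+
  qed
  have z_adj: "closed_adj \<Gamma> u z \<longleftrightarrow> u \<in> A\<^sub>z'" "closed_adj \<Gamma> z u \<longleftrightarrow> u \<in> A\<^sub>z'" if "u \<in> A" for u
  proof -
    have "u \<noteq> z"
      using not_far[of 1 u] N z_far that A_P1 by auto
    moreover have "u \<in> points \<P>" "z \<in> points \<P>"
      using that z by (auto simp: A_def affine_part_def points_in_def)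
    ultimately show "closed_adj \<Gamma> u z \<longleftrightarrow> u \<in> A\<^sub>z'" "closed_adj \<Gamma> z u \<longleftrightarrow> u \<in> A\<^sub>z'"
      using closed_adj_iff adj_iff[OF that z_far] \<sigma>\<^sub>1_simps(1) Az by auto
  qed

  \<comment> \<open>Two points of \<open>l\<close> other than \<open>z\<close>\<close>
  define y where "y = a + b"
  \<comment> \<open>Every line has at least three points; \<open>a + b\<close> yields a third one
    over any field, and orthogonality to \<open>b\<close> and \<open>y\<close> gives orthogonality
    to \<open>a = y - b\<close>.\<close>
  have y: "y \<in> l" "y \<notin> vec.span {a}"
  proof -
    show "y \<in> l"
      using \<open>a \<in> l\<close> b(1) sub(3) by (simp add: y_def vec.subspace_add)
    show "y \<notin> vec.span {a}"
      using b(2) vec.span_diff[of y "{a}" a] by (auto simp: y_def vec.span_base)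
  qed
  have b0: "b \<noteq> 0" and y0: "y \<noteq> 0"
    using b(2) y(2) vec.span_zero by metis+
  have Sg: "b \<in> Sg" "y \<in> Sg"
    using l_Sg b(1) y(1) by blast+
  have yb: "y \<notin> vec.span {b}"
  proof
    assume "y \<in> vec.span {b}"
    then have "y - b \<in> vec.span {b}"
      by (intro vec.span_diff) (auto intro: vec.span_base)
    then have "vec.span {b} = vec.span {a}"
      using span_singleton_eqI[of a b] a(1) by (simp add: y_def)
    then show False
      using b(2) vec.span_base[of b "{b}"] by simp
  qed
  have "b \<notin> vec.span {y}"
    using span_singleton_eqI[of b y] b0 yb vec.span_base[of y "{y}"] by auto
  have b_perp_y: "b \<perp> y"
    using l_orth b(1) y(1) .

  \<comment> \<open>Contradiction from a set \<open>K\<close> for the edge between the points of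
    \<open>b\<close> and \<open>y\<close>\<close>
  assume "on_thick_lines (CARD('a) + 1) (switched_graph \<P> L N P ((\<lambda>i. id)(1 := \<sigma>\<^sub>1)))"
  then have thick: "on_thick_lines (CARD('a) + 1) \<Gamma>"
    by (simp add: \<Gamma>_def \<sigma>_def)
  have "vec.span {b} \<noteq> vec.span {y}"
    using yb vec.span_base[of y "{y}"] by auto
  moreover have "closed_adj \<Gamma> (vec.span {b}) (vec.span {y})"
    using closed_adj_line(1)[OF b Sg(2) y0] b_perp_y by simp
  ultimately have "(vec.span {b}, vec.span {y}) \<in> parcs \<Gamma>"
    by (simp add: closed_adj_def)
  then obtain K where K: "K \<subseteq> pverts \<Gamma>" "card K = CARD('a) + 1"
    and K_adj: "\<And>v k. v \<in> pverts \<Gamma> \<Longrightarrow> closed_adj \<Gamma> (vec.span {b}) v \<Longrightarrow>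
      closed_adj \<Gamma> (vec.span {y}) v \<Longrightarrow> k \<in> K \<Longrightarrow> closed_adj \<Gamma> k v"
    using thick unfolding on_thick_lines_def by meson
  have verts: "pverts \<Gamma> = points \<P>"
    by (simp add: \<Gamma>_def switched_graph_def)
  have "k \<in> points_in \<P> l - {z}" if k: "k \<in> K" for k
  proof -
    have common: "closed_adj \<Gamma> k (vec.span {s})" if "s \<in> Sg" "s \<noteq> 0" "b \<perp> s" "y \<perp> s" for s
      using K_adj[OF _ _ _ k] closed_adj_line(1)[OF b] closed_adj_line(1)[OF y] that
      by (simp add: verts point_span)
    have k_point: "k \<in> points \<P>"
      using k K(1) verts by blast
    then obtain w where w: "w \<noteq> 0" "w \<in> Sg" "k = vec.span {w}"
      by (auto elim: pointE)
    \<comment> \<open>The points of \<open>b\<close> and \<open>y\<close> are themselves common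
      closed neighbours of the two ends.\<close>
    have wb: "w \<perp> b"
      using common[OF Sg(1) b0] closed_adj_line(2)[OF b w(2,1)] l_orth b(1) y(1) w(3) by blast
    have wy: "w \<perp> y"
      using common[OF Sg(2) y0] closed_adj_line(2)[OF y w(2,1)] l_orth b(1) y(1) w(3) by blast
    have wa: "w \<perp> a"
      using orth_diff[OF wy wb] by (simp add: y_def)
    have kp: "closed_adj \<Gamma> k (vec.span {p})"
      using common[OF p_Sg p0] lp b(1) y(1) by blast
    have kz: "closed_adj \<Gamma> k z"
      using common[OF a(2,1)] l_orth b(1) y(1) \<open>a \<in> l\<close> a(3) by blast
    \<comment> \<open>The point of \<open>p\<close> is a common neighbour of the two ends, but the
      switching has removed it from the neighbours of \<open>z\<close>.\<close>
    have "k \<noteq> z"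
      using kp z_adj(2)[OF p_A] p_Az' by blast
    have "w \<in> l"
    proof (rule ccontr)
      assume "w \<notin> l"
      have "vec.span {b, y} \<subseteq> l"
        using b(1) y(1) sub(3) by (intro vec.span_minimal) auto
      then have "w \<notin> vec.span {b, y}"
        using \<open>w \<notin> l\<close> by blast
      then obtain v where v: "v \<in> Sg" "b \<perp> v" "y \<perp> v" "\<not> w \<perp> v"
        using separating_vector[OF Sg w(2) b_perp_y orth_sym[OF wb] orth_sym[OF wy]
            \<open>b \<notin> vec.span {y}\<close> yb] by blast
      then have "v \<noteq> 0"
        using orth_zero by blast
      then have "closed_adj \<Gamma> k (vec.span {v})"
        using common v by blast
      \<comment> \<open>In the switched graph \<open>k\<close> is adjacent or equal to the point of
        \<open>v\<close> although \<open>w\<close> and \<open>v\<close> are not orthogonal, so this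
        pair has been switched.\<close>
      then have "sw k (vec.span {v}) \<or> sw (vec.span {v}) k"
        using closed_adj_orth[OF _ _ w(2,1) v(1) \<open>v \<noteq> 0\<close>] v(4) w(3) by blast
      then show False
      proof
        assume "sw k (vec.span {v})"
        then have kA: "k \<in> A"
          by (simp add: sw_def)
        \<comment> \<open>If \<open>k\<close> is in \<open>A\<close>, orthogonality to
          \<open>a\<close> puts it into \<open>A\<^sub>z\<close>, while its adjacency to
          \<open>z\<close> after switching puts it into the disjoint set
          \<open>A\<^sub>z'\<close>.\<close>
        then have "k \<in> A\<^sub>z"
          using Az wa orth_commute span_singletons_perp_iff[OF a(2,1) w(2,1)] a(3) w(3) by blast
        moreover have "k \<in> A\<^sub>z'"
          using kz z_adj(1)[OF kA] by blast
        ultimately show False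
          using disjoint by blast
      next
        assume "sw (vec.span {v}) k"
        then have far: "k \<in> far_points \<P> L" and kA: "perp \<P> k \<inter> A = A\<^sub>z \<or> perp \<P> k \<inter> A = A\<^sub>z'"
          by (auto simp: sw_def)
        have far_A: "k \<notin> A"
          using not_far[of 1 k] N far A_P1 by auto
        then have "k \<noteq> vec.span {p}"
          using p_A by blast
        then have "vec.span {p} \<in> \<sigma>\<^sub>1 (perp \<P> k \<inter> A)"
          using kp closed_adj_iff[OF k_point point_span[OF p_Sg p0]] adj_iff(2)[OF p_A far] by blast
        \<comment> \<open>If the hyperplane of \<open>k\<close> were \<open>A\<^sub>z\<close>, its
          image \<open>A\<^sub>z'\<close> would contain the point of \<open>p\<close>.\<close>
        then have "perp \<P> k \<inter> A = A\<^sub>z'"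
          using kA \<sigma>\<^sub>1_simps(1) p_Az' by auto
        then have "\<not> w \<perp> p"
          using p_A p_Az' span_singletons_perp_iff[OF w(2,1) p_Sg p0] w(3) by blast
        \<comment> \<open>The vector \<open>p + b\<close> is also orthogonal to \<open>b\<close> and
          \<open>y\<close>, but lies outside \<open>G\<close>. Its adjacency to \<open>k\<close> is
          therefore unswitched and yields \<open>w \<perp> p + b\<close>, hence
          \<open>w \<perp> p\<close>.\<close>
        have "p + b \<notin> G"
          using pG vec.subspace_diff[OF sub(2), of "p + b" p] lG b(1) b0 by auto
        then have pb0: "p + b \<noteq> 0"
          using vec.subspace_0[OF sub(2)] by metis
        have pb_Sg: "p + b \<in> Sg"
          using lp[OF b(1)] orth_sym by (intro Sg_add p_Sg Sg) blast
        have "closed_adj \<Gamma> k (vec.span {p + b})"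
          using lp b(1) y(1) l_orth by (intro common pb_Sg pb0 orth_add) blast+
        moreover have "\<not> sw k (vec.span {p + b})" "\<not> sw (vec.span {p + b}) k"
          using far_A span_A[OF pb_Sg] \<open>p + b \<notin> G\<close> by (auto simp: sw_def)
        ultimately have "w \<perp> p + b"
          using closed_adj_orth[OF _ _ w(2,1) pb_Sg pb0] w(3) by blast
        then have "w \<perp> (p + b) - b"
          using wb by (rule orth_diff)
        then show False
          using \<open>\<not> w \<perp> p\<close> by simp
      qed
    qed
    then show ?thesis
      using span_singleton_in_points_in[OF l(1) w(2,1)] w(3) \<open>k \<noteq> z\<close> by blast
  qed
  then have "K \<subseteq> points_in \<P> l - {z}"
    by blast
  then have "card K \<le> card (points_in \<P> l - {z})"
    by (rule card_mono[rotated]) simp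
  also have "\<dots> < card (points_in \<P> l)"
    using z by (intro card_Diff1_less) simp
  also have "\<dots> = CARD('a) + 1"
    unfolding l_span
    using card_points_in_line[OF a(2,1) Sg(1) b(2)] l_orth \<open>a \<in> l\<close> b(1) by blast
  finally show False
    using K(2) by simp
qed

end

theorem corollary4p4:
  fixes \<P> :: "('a::{field,finite} ^ 'n::finite) set set"
    and d N :: nat and e :: real
    and L \<pi> l z H\<^sub>z H\<^sub>z' :: "('a ^ 'n) set"
    and P :: "nat \<Rightarrow> ('a ^ 'n) set"
    and \<sigma>\<^sub>1 :: "('a ^ 'n) set set \<Rightarrow> ('a ^ 'n) set set"
  assumes "d \<ge> 3"
    and "classical_polar_space d e \<P>"
    and "L \<in> \<P>" and "vec.dim L = d - 1"
    and "real N = real CARD('a) powr e + 1"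
    and "bij_betw P {1..N} {G \<in> generators \<P>. L \<subseteq> G}"
    and "\<pi> \<in> \<P>" and "\<pi> \<subseteq> P 1" and "vec.dim \<pi> = d - 2" and "\<not> \<pi> \<subseteq> L"
    and "l \<in> \<P>" and "vec.dim l = 2" and "points_in \<P> l \<subseteq> perp \<P> \<pi>" and "l \<inter> P 1 = {0}"
    and "z \<in> points_in \<P> l"
    and "H\<^sub>z \<in> \<P>" and "points_in \<P> H\<^sub>z = perp \<P> z \<inter> points_in \<P> (P 1)"
    and "H\<^sub>z' \<in> \<P>" and "H\<^sub>z' \<subseteq> P 1" and "vec.dim H\<^sub>z' = d - 1" and "H\<^sub>z' \<noteq> H\<^sub>z"
    and "parallel \<P> L (P 1) (affine_part \<P> L H\<^sub>z) (affine_part \<P> L H\<^sub>z')"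
    and "\<sigma>\<^sub>1 = Transposition.transpose (affine_part \<P> L H\<^sub>z) (affine_part \<P> L H\<^sub>z')"
  shows "\<not> digraph_iso (with_proj (collinearity_graph \<P>))
                       (with_proj (switched_graph \<P> L N P ((\<lambda>i. id)(1 := \<sigma>\<^sub>1))))"
proof -
  obtain Sg orth where "polar_perp \<P> Sg orth"
    using classical_polar_space_polar_perp[OF assms(2)] by blast
  then interpret finite_polar_perp \<P> Sg orth
    by (simp add: finite_polar_perp_def)
  \<comment> \<open>This guarantees that the index 1 of the switched generator is in range.\<close>
  have "real N \<ge> 1"
    using assms(5) by simp
  then have "N \<ge> 1"
    by simp
  then have "\<not> on_thick_lines (CARD('a) + 1) (switched_graph \<P> L N P ((\<lambda>i. id)(1 := \<sigma>\<^sub>1)))"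
    using assms by (intro switched_graph_not_on_thick_lines[of L P N \<pi> l z H\<^sub>z H\<^sub>z']) auto
  then show ?thesis
    using on_thick_lines_iso collinearity_graph_on_thick_lines by blast
qed

end
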